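(* Let $d\ge2$ and fix an increasing function $\Phi:[0,\infty)\to[0,\infty)$ satisfying $\Phi(0)=0$ and $\lim_{r\to\infty}\Phi(r)=\infty$. Then there exist a divergence-free velocity field $b:[0,\infty)\times\mathbb{R}^d\to\mathbb{R}^d$ satisfying $$\operatorname{supp}b_t\subset B_{1/2}\quad\forall t\ge0;\qquad \sup_{t>0}\int_{B_{1/2}}\Phi(|\nabla b_t(x)|)\,dx<\infty,$$ and $u_0\in C^1_c(B_{1/2})$ such that $\operatorname{supp}u_t\subset B_{1/2}$ for all $t\ge0$ and $$\|\nabla u_t\|_{L^\infty}=\infty\qquad\forall t>0,$$ where $u\in L^\infty([0,\infty)\times\mathbb{R}^d)$ is the solution of $\partial_tu+b\cdot\nabla_xu=0$ with initial data $u_0$.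
   Context: $B_r$ is the open ball of radius $r$ centered at the origin of $\mathbb{R}^d$; $f_t=f(t,\cdot)$; derivatives of $b$ are spatial and distributional. Solutions of the transport equation are understood in the distributional sense. $\|\nabla u_t\|_{L^\infty}=\infty$ means that $u_t$ does not have a distributional gradient in $L^\infty(\mathbb{R}^d)$. *)

theory Defs
  imports "HOL-Analysis.Analysis"
begin

text \<open>
  Measurability is Borel measurability throughout: every class of Lebesgue measurable functions
  modulo null sets has a Borel representative, so no class is lost.  Values of time-dependent
  functions at negative times are irrelevant.
\<close>

definition pderiv_dir :: "('a::real_normed_vector \<Rightarrow> real) \<Rightarrow> 'a \<Rightarrow> 'a \<Rightarrow> real" where
  "pderiv_dir f e x = frechet_derivative f (at x) e"

fun Ck :: "nat \<Rightarrow> ('a::euclidean_space \<Rightarrow> real) \<Rightarrow> bool" where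
  "Ck 0 f \<longleftrightarrow> continuous_on UNIV f"
| "Ck (Suc k) f \<longleftrightarrow> (\<forall>x. f differentiable (at x)) \<and> (\<forall>e\<in>Basis. Ck k (pderiv_dir f e))"

definition supp :: "('a::topological_space \<Rightarrow> 'b::zero) \<Rightarrow> 'a set" where
  "supp f = closure {x. f x \<noteq> 0}"

definition test_function :: "('a::euclidean_space \<Rightarrow> real) \<Rightarrow> bool" where
  "test_function \<phi> \<longleftrightarrow> (\<forall>k. Ck k \<phi>) \<and> compact (supp \<phi>)"

text \<open>The support of a class of functions modulo null sets, i.e. the support of \<open>f\<close> as a
  distribution.\<close>

definition ess_supp :: "('a::euclidean_space \<Rightarrow> 'b::zero) \<Rightarrow> 'a set" where
  "ess_supp f = - \<Union>{U. open U \<and> (AE x in lborel. x \<in> U \<longrightarrow> f x = 0)}"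

definition locally_integrable ::
  "('a::euclidean_space) set \<Rightarrow> ('a \<Rightarrow> 'b::{banach, second_countable_topology}) \<Rightarrow> bool" where
  "locally_integrable S f \<longleftrightarrow> (\<forall>K. compact K \<and> K \<subseteq> S \<longrightarrow> set_integrable lborel K f)"

definition L_infinity ::
  "('a::euclidean_space) set \<Rightarrow> ('a \<Rightarrow> 'b::euclidean_space) \<Rightarrow> bool" where
  "L_infinity S f \<longleftrightarrow>
     set_borel_measurable lborel S f \<and> (\<exists>C. AE x in lborel. x \<in> S \<longrightarrow> norm (f x) \<le> C)"

definition weak_gradient :: "(real ^ 'n \<Rightarrow> real) \<Rightarrow> (real ^ 'n \<Rightarrow> real ^ 'n) \<Rightarrow> bool" where
  "weak_gradient f g \<longleftrightarrow> locally_integrable UNIV f \<and> locally_integrable UNIV g \<and>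
     (\<forall>\<phi> i. test_function \<phi> \<longrightarrow>
        (\<integral>x. f x * pderiv_dir \<phi> (axis i 1) x \<partial>lborel) = - (\<integral>x. g x $ i * \<phi> x \<partial>lborel))"

text \<open>Row \<open>i\<close> of the Jacobian is the gradient of the \<open>i\<close>-th component. The norm on
  \<^typ>\<open>real ^ 'n ^ 'n\<close> is the Frobenius norm.\<close>

definition weak_jacobian ::
  "(real ^ 'n \<Rightarrow> real ^ 'n) \<Rightarrow> (real ^ 'n \<Rightarrow> real ^ 'n ^ 'n) \<Rightarrow> bool" where
  "weak_jacobian v G \<longleftrightarrow> (\<forall>i. weak_gradient (\<lambda>x. v x $ i) (\<lambda>x. G x $ i))"

definition divergence_free :: "(real ^ 'n \<Rightarrow> real ^ 'n) \<Rightarrow> bool" where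
  "divergence_free v \<longleftrightarrow> locally_integrable UNIV v \<and>
     (\<forall>\<phi>. test_function \<phi> \<longrightarrow>
        (\<integral>x. (\<Sum>i\<in>UNIV. v x $ i * pderiv_dir \<phi> (axis i 1) x) \<partial>lborel) = 0)"

text \<open>
  A time-dependent divergence-free velocity field on \<open>[0,\<infinity>) \<times> \<real>\<^sup>d\<close>. Local integrability in space-time
  is what is needed to give \<open>b \<cdot> \<nabla>u = div (b u)\<close> a distributional meaning for bounded \<open>u\<close>.
\<close>

definition divergence_free_field :: "(real \<Rightarrow> real ^ 'n \<Rightarrow> real ^ 'n) \<Rightarrow> bool" where
  "divergence_free_field b \<longleftrightarrow>
     locally_integrable ({0..} \<times> UNIV) (\<lambda>(t, x). b t x) \<and> (\<forall>t\<ge>0. divergence_free (b t))"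

text \<open>
  Distributional solutions in \<open>L\<^sup>\<infinity>([0,\<infinity>) \<times> \<real>\<^sup>d)\<close> of \<open>\<partial>\<^sub>t u + b \<cdot> \<nabla>\<^sub>x u = 0\<close> with initial datum \<open>u0\<close>, for
  divergence-free \<open>b\<close>. The test functions need not vanish at time \<open>0\<close>; this encodes the initial
  condition.
\<close>

definition transport_solution ::
  "(real \<Rightarrow> real ^ 'n \<Rightarrow> real ^ 'n) \<Rightarrow> (real ^ 'n \<Rightarrow> real) \<Rightarrow> (real \<Rightarrow> real ^ 'n \<Rightarrow> real) \<Rightarrow> bool" where
  "transport_solution b u0 u \<longleftrightarrow>
     L_infinity ({0..} \<times> UNIV) (\<lambda>(t, x). u t x) \<and>
     (\<forall>\<phi> :: real \<times> (real ^ 'n) \<Rightarrow> real. test_function \<phi> \<longrightarrow>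
        (LINT (t, x):{0..} \<times> UNIV|lborel.
            u t x * (pderiv_dir \<phi> (1, 0) (t, x)
                     + (\<Sum>i\<in>UNIV. b t x $ i * pderiv_dir \<phi> (0, axis i 1) (t, x))))
        + (\<integral>x. u0 x * \<phi> (0, x) \<partial>lborel) = 0)"

text \<open>
  A bounded distributional solution is determined only up to space-time null sets. Its value \<open>u\<^sub>t\<close> at
  each individual time is that of its representative which is continuous on \<open>[0,\<infinity>)\<close> with values in
  \<open>L\<^sup>\<infinity>(\<real>\<^sup>d)\<close> with the weak-star topology; for every \<open>t\<close> this determines \<open>u\<^sub>t\<close> up to a null set.
\<close>

definition weak_star_continuous :: "(real \<Rightarrow> real ^ 'n \<Rightarrow> real) \<Rightarrow> bool" where
  "weak_star_continuous u \<longleftrightarrow>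
     (\<forall>t\<ge>0. L_infinity UNIV (u t)) \<and>
     (\<forall>g. integrable lborel g \<longrightarrow> continuous_on {0..} (\<lambda>t. \<integral>x. u t x * g x \<partial>lborel))"

text \<open>\<open>u\<close> is the solution of the transport equation, i.e. the only one as an element of \<open>L\<^sup>\<infinity>\<close>, given
  by its weak-star continuous representative.\<close>

definition the_transport_solution ::
  "(real \<Rightarrow> real ^ 'n \<Rightarrow> real ^ 'n) \<Rightarrow> (real ^ 'n \<Rightarrow> real) \<Rightarrow> (real \<Rightarrow> real ^ 'n \<Rightarrow> real) \<Rightarrow> bool" where
  "the_transport_solution b u0 u \<longleftrightarrow>
     transport_solution b u0 u \<and> weak_star_continuous u \<and>
     (\<forall>v. transport_solution b u0 v \<longrightarrow>
        (AE (t, x) in lborel. t \<ge> 0 \<longrightarrow> v t x = u t x))"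

end

theory Submission
  imports Defs
begin

text \<open>
  The field is stationary: a single vortex around the origin that turns every sphere rigidly, in the plane of two
  coordinate axes, with an angular speed that depends only on \<open>\<bar>x\<bar>\<^sup>2\<close>. Such a field is divergence-free, its flow
  rotates \<open>x\<close> by the angle \<open>t * speed (\<bar>x\<bar>\<^sup>2)\<close>, and the solution is the initial datum composed with the inverse
  rotation. The gradient of the solution at time \<open>t\<close> is of size \<open>t * \<bar>x\<bar>\<^sup>2 * speed' (\<bar>x\<bar>\<^sup>2)\<close> wherever the datum has
  a gradient of size \<open>1\<close>, so it suffices that this quantity, which also measures the gradient of the velocity, is
  unbounded.

  The angular speed consists of bumps on disjoint shells \<open>\<rho> n / 4 < \<bar>x\<bar>\<^sup>2 < \<rho> n\<close> that shrink to the origin, with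
  amplitude proportional to \<open>n\<close> in the \<open>n\<close>-th shell. By scaling, the velocity gradient in that shell is bounded by \<open>C * n\<close> with \<open>C\<close>
  independent of the radii. Choosing \<open>\<rho> n\<close> so small that \<open>\<Phi> (C * n) * \<rho> n\<close> is summable makes the integral of
  \<open>\<Phi> (\<bar>\<nabla>b\<bar>)\<close> finite (\<open>nn_integral_Db_finite\<close>), for any growth of \<open>\<Phi>\<close>, while the gradient of the solution in the
  \<open>n\<close>-th shell grows like \<open>n * t\<close>, whatever \<open>t > 0\<close> is (\<open>no_bounded_weak_gradient\<close>). The datum is a coordinate function near the
  origin, up to a cutoff.

  The field is not Lipschitz at the origin, so uniqueness among bounded distributional solutions is not immediate. But
  the flow is explicit, preserves Lebesgue measure (\<open>preserves_lborel_space_time_flow\<close>), is smooth away from the origin and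
  preserves the distance to the origin. Hence a function of the moving coordinates that vanishes near the origin is an
  admissible test function (\<open>test_function_along_flow\<close>). In these coordinates the equation says that the time
  derivative vanishes, and the difference of two solutions integrates to zero over all boxes
  (\<open>transport_solution_unique\<close>). The same change of variables shows that the transported datum is a solution
  (\<open>transport_solution_transported\<close>).

  Everything that is not smooth at the origin (the weak Jacobian, the test functions, the solution) is compared with the
  vortex in which only the first \<open>N\<close> shells are kept. It is smooth, and at each point other than the origin it agrees with
  the full vortex for large \<open>N\<close>.
\<close>

section \<open>Smooth functions\<close>

definition smooth :: "('a::euclidean_space \<Rightarrow> real) \<Rightarrow> bool" where
  "smooth f \<longleftrightarrow> (\<forall>k. Ck k f)"

lemma pderiv_dir_eq:
  assumes "(f has_derivative f') (at x)"
  shows "pderiv_dir f e x = f' e"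
  using frechet_derivative_at[OF assms] by (simp add: pderiv_dir_def)

lemma Ck_Suc_differentiable: "Ck (Suc k) f \<Longrightarrow> f differentiable (at x)"
  by simp

lemma Ck_continuous: "Ck k f \<Longrightarrow> continuous_on UNIV f"
  by (cases k) (auto simp: differentiable_imp_continuous_within continuous_on_eq_continuous_at)

lemma Ck_Suc_imp_Ck: "Ck (Suc k) f \<Longrightarrow> Ck k f"
proof (induction k arbitrary: f)
  case 0
  then show ?case using Ck_continuous[of "Suc 0" f] by simp
next
  case (Suc k)
  then show ?case by (metis Ck.simps(2))
qed

lemma Ck_SucI:
  assumes "\<And>x. (f has_derivative D x) (at x)" "\<And>e. e \<in> Basis \<Longrightarrow> Ck k (\<lambda>x. D x e)"
  shows "Ck (Suc k) f"
proof -
  have "pderiv_dir f e = (\<lambda>x. D x e)" for e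
    using pderiv_dir_eq[OF assms(1)] by blast
  with assms show ?thesis by (auto simp: differentiable_def)
qed

lemma Ck_has_derivative:
  assumes "Ck (Suc k) f"
  shows "(f has_derivative (\<lambda>e. pderiv_dir f e x)) (at x)"
  using assms by (simp add: pderiv_dir_def[abs_def] frechet_derivative_works[symmetric])

lemma Ck_const: "Ck k (\<lambda>x. c)"
proof (induction k arbitrary: c)
  case (Suc k)
  show ?case by (rule Ck_SucI[where D="\<lambda>_ _. 0"]) (auto intro: Suc)
qed simp

lemma Ck_inner: "Ck k (\<lambda>x. x \<bullet> v)"
proof (cases k)
  case (Suc j)
  show ?thesis unfolding Suc
    by (rule Ck_SucI[where D="\<lambda>_ e. e \<bullet> v"]) (auto intro!: derivative_eq_intros Ck_const)
qed (auto intro: continuous_intros)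

lemma Ck_add: "Ck k f \<Longrightarrow> Ck k g \<Longrightarrow> Ck k (\<lambda>x. f x + g x)"
proof (induction k arbitrary: f g)
  case (Suc k)
  show ?case
    by (rule Ck_SucI[where D="\<lambda>x e. pderiv_dir f e x + pderiv_dir g e x"])
      (use Suc in \<open>auto intro!: has_derivative_add Ck_has_derivative\<close>)
qed (auto intro: continuous_intros)

lemma Ck_mult: "Ck k f \<Longrightarrow> Ck k g \<Longrightarrow> Ck k (\<lambda>x. f x * g x)"
proof (induction k arbitrary: f g)
  case (Suc k)
  show ?case
  proof (rule Ck_SucI[where D="\<lambda>x e. f x * pderiv_dir g e x + pderiv_dir f e x * g x"])
    show "((\<lambda>x. f x * g x) has_derivative (\<lambda>e. f x * pderiv_dir g e x + pderiv_dir f e x * g x)) (at x)" for x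
      using Suc.prems by (intro has_derivative_mult Ck_has_derivative)
    have "Ck k f" "Ck k g" using Suc.prems Ck_Suc_imp_Ck by blast+
    then show "Ck k (\<lambda>x. f x * pderiv_dir g e x + pderiv_dir f e x * g x)" if "e \<in> Basis" for e
      using Suc.prems that by (intro Ck_add Suc.IH) auto
  qed
qed (auto intro: continuous_intros)

lemma pderiv_dir_real: "(f has_real_derivative d) (at x) \<Longrightarrow> pderiv_dir f e x = d * e"
  unfolding has_field_derivative_def by (rule pderiv_dir_eq)

lemma Ck_real_has_derivative:
  "Ck (Suc k) f \<Longrightarrow> (f has_real_derivative pderiv_dir f 1 x) (at (x::real))"
  using Ck_has_derivative[of k f x] pderiv_dir_real
  by (metis Ck_Suc_differentiable mult.right_neutral real_differentiableE real_differentiable_def)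

lemma Ck_compose:
  fixes g :: "real \<Rightarrow> real"
  shows "Ck k g \<Longrightarrow> Ck k f \<Longrightarrow> Ck k (\<lambda>x. g (f x))"
proof (induction k arbitrary: f g)
  case 0
  then show ?case by (auto intro: continuous_on_compose2)
next
  case (Suc k)
  show ?case
  proof (rule Ck_SucI[where D="\<lambda>x e. pderiv_dir g 1 (f x) * pderiv_dir f e x"])
    show "((\<lambda>x. g (f x)) has_derivative (\<lambda>e. pderiv_dir g 1 (f x) * pderiv_dir f e x)) (at x)" for x
    proof -
      have "(g has_derivative (\<lambda>h. pderiv_dir g 1 (f x) * h)) (at (f x))"
        using Ck_real_has_derivative[OF Suc.prems(1)] by (simp add: has_field_derivative_def)
      from has_derivative_compose[OF Ck_has_derivative[OF Suc.prems(2)] this]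
      show ?thesis by simp
    qed
    have "Ck k f" using Suc.prems Ck_Suc_imp_Ck by blast
    then show "Ck k (\<lambda>x. pderiv_dir g 1 (f x) * pderiv_dir f e x)" if "e \<in> Basis" for e
      using Suc.prems that by (intro Ck_mult Suc.IH[of "pderiv_dir g 1" f]) auto
  qed
qed

lemma smooth_const [intro, simp]: "smooth (\<lambda>x. c)"
  and smooth_inner [intro]: "smooth (\<lambda>x. x \<bullet> v)"
  and smooth_add [intro]: "smooth f \<Longrightarrow> smooth g \<Longrightarrow> smooth (\<lambda>x. f x + g x)"
  and smooth_mult [intro]: "smooth f \<Longrightarrow> smooth g \<Longrightarrow> smooth (\<lambda>x. f x * g x)"
  and smooth_compose: "smooth k \<Longrightarrow> smooth f \<Longrightarrow> smooth (\<lambda>x. k (f x))"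
  by (auto simp: smooth_def Ck_const Ck_inner Ck_add Ck_mult intro: Ck_compose)

lemma smooth_minus [intro]: "smooth f \<Longrightarrow> smooth (\<lambda>x. - f x)"
  using smooth_mult[OF smooth_const[of "-1"]] by simp

lemma smooth_diff [intro]: "smooth f \<Longrightarrow> smooth g \<Longrightarrow> smooth (\<lambda>x. f x - g x)"
  using smooth_add[OF _ smooth_minus[of g]] by simp

lemma smooth_sum: "(\<And>i. i \<in> I \<Longrightarrow> smooth (f i)) \<Longrightarrow> smooth (\<lambda>x. \<Sum>i\<in>I. f i x)"
  by (induction I rule: infinite_finite_induct) auto

lemma smooth_prod: "(\<And>i. i \<in> I \<Longrightarrow> smooth (f i)) \<Longrightarrow> smooth (\<lambda>x. \<Prod>i\<in>I. f i x)"
  by (induction I rule: infinite_finite_induct) auto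

lemma smooth_ident: "smooth (\<lambda>x::real. x)"
  using smooth_inner[of "1::real"] by simp

lemma smooth_inner_self: "smooth (\<lambda>x. x \<bullet> x)"
  unfolding euclidean_inner[of x x for x] by (intro smooth_sum smooth_mult smooth_inner)

lemma smooth_has_derivative: "smooth f \<Longrightarrow> (f has_derivative (\<lambda>e. pderiv_dir f e x)) (at x)"
  unfolding smooth_def by (blast intro: Ck_has_derivative)

lemma smooth_pderiv_dir: "smooth f \<Longrightarrow> e \<in> Basis \<Longrightarrow> smooth (pderiv_dir f e)"
  unfolding smooth_def by (meson Ck.simps(2))

lemma smooth_has_real_derivative:
  "smooth f \<Longrightarrow> (f has_real_derivative pderiv_dir f 1 x) (at (x::real))"
  unfolding smooth_def by (blast intro: Ck_real_has_derivative)

lemma smooth_continuous: "smooth f \<Longrightarrow> continuous_on UNIV f"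
  unfolding smooth_def using Ck_continuous by blast

lemma smooth_realI:
  assumes "\<And>x::real. (f has_real_derivative f' x) (at x)" "smooth f'"
  shows "smooth f"
  unfolding smooth_def
proof
  fix k
  have "Ck (Suc k) f"
    by (rule Ck_SucI[where D="\<lambda>x e. f' x * e"])
      (use assms in \<open>auto simp: has_field_derivative_def smooth_def\<close>)
  then show "Ck k f" by (rule Ck_Suc_imp_Ck)
qed

text \<open>
  Differentiating the sine shifts its phase by a quarter period, so the family of all shifts is closed
  under differentiation; it contains the cosine.
\<close>

lemma smooth_sin_shift: "smooth (\<lambda>x::real. sin (x + a))"
proof -
  have "Ck k (\<lambda>x::real. sin (x + a))" for k
  proof (induction k arbitrary: a)
    case (Suc k)
    have *: "((\<lambda>x. sin (x + a)) has_derivative (\<lambda>e. sin (x + (a + pi/2)) * e)) (at x)" for x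
    proof -
      have "sin (x + (a + pi / 2)) = cos (x + a)"
        using sin_add[of "x + a" "pi / 2"] by (simp only: add.assoc) simp
      then show ?thesis by (auto intro!: derivative_eq_intros)
    qed
    show ?case
      by (rule Ck_SucI[OF *]) (use Suc in auto)
  qed (auto intro!: continuous_intros)
  then show ?thesis by (simp add: smooth_def)
qed

lemma smooth_sin: "smooth f \<Longrightarrow> smooth (\<lambda>x. sin (f x))"
  and smooth_cos: "smooth f \<Longrightarrow> smooth (\<lambda>x. cos (f x))"
  using smooth_compose[OF smooth_sin_shift[of 0]] smooth_compose[OF smooth_sin_shift[of "pi/2"]]
  by (simp_all add: sin_add)

lemma tendsto_exp_inverse_div_power:
  "((\<lambda>x::real. exp (- 1 / x) / x ^ m) \<longlongrightarrow> 0) (at_right 0)"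
proof -
  have "((\<lambda>x::real. (inverse x) ^ m / exp (inverse x)) \<longlongrightarrow> 0) (at_right 0)"
    by (rule filterlim_compose[OF tendsto_power_div_exp_0 filterlim_inverse_at_top_right])
  then show ?thesis
    by (simp add: exp_minus field_simps)
qed

text \<open>
  The functions \<open>exp (- 1 / x) / x ^ m\<close>, extended by \<open>0\<close>: the denominators make the span of the family
  closed under differentiation, which turns the smoothness of \<open>exp (- 1 / x)\<close> into an induction.
\<close>

definition flat_exp :: "nat \<Rightarrow> real \<Rightarrow> real" where
  "flat_exp m x = (if x > 0 then exp (- 1 / x) / x ^ m else 0)"

lemma flat_exp_tendsto_0: "(flat_exp m \<longlongrightarrow> 0) (at 0)"
  unfolding filterlim_at_split
proof
  show "(flat_exp m \<longlongrightarrow> 0) (at_left 0)"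
    by (rule tendsto_eventually) (auto simp: flat_exp_def eventually_at_filter)
  show "(flat_exp m \<longlongrightarrow> 0) (at_right 0)"
    by (rule Lim_transform_eventually[OF tendsto_exp_inverse_div_power[of m]])
      (auto simp: flat_exp_def eventually_at_filter)
qed

lemma flat_exp_has_derivative:
  "(flat_exp m has_real_derivative (flat_exp (m + 2) x + (- real m) * flat_exp (m + 1) x)) (at x)"
proof -
  consider "x > 0" | "x < 0" | "x = 0" by linarith
  then show ?thesis
  proof cases
    case 1
    have "((\<lambda>x. exp (- 1 / x) / x ^ m) has_real_derivative
        (flat_exp (m + 2) x + (- real m) * flat_exp (m + 1) x)) (at x)"
    proof -
      have "m = 0 \<or> m = 1 \<or> (\<exists>j. m = Suc (Suc j))"
        by (metis One_nat_def not0_implies_Suc)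
      with 1 show ?thesis
        by (auto intro!: derivative_eq_intros
            simp: flat_exp_def field_simps power2_eq_square power_add)
    qed
    then show ?thesis
      by (rule has_field_derivative_transform_within_open[where S="{0<..}"])
        (use 1 in \<open>auto simp: flat_exp_def\<close>)
  next
    case 2
    have "((\<lambda>x. 0) has_real_derivative 0) (at x)" by simp
    then have "(flat_exp m has_real_derivative 0) (at x)"
      by (rule has_field_derivative_transform_within_open[where S="{..<0}"])
        (use 2 in \<open>auto simp: flat_exp_def\<close>)
    with 2 show ?thesis by (simp add: flat_exp_def)
  next
    case 3
    have "((\<lambda>y. (flat_exp m y - flat_exp m 0) / (y - 0)) \<longlongrightarrow> 0) (at 0)"
      by (rule Lim_transform_eventually[OF flat_exp_tendsto_0[of "m + 1"]])
        (auto simp: flat_exp_def eventually_at_filter)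
    then show ?thesis
      by (simp add: 3 has_field_derivative_iff flat_exp_def)
  qed
qed

lemma Ck_flat_exp: "Ck k (flat_exp m)"
proof (induction k arbitrary: m)
  case 0
  show ?case
    using flat_exp_has_derivative[THEN DERIV_isCont] by (simp add: continuous_at_imp_continuous_on)
next
  case (Suc k)
  show ?case
    by (rule Ck_SucI[OF flat_exp_has_derivative[unfolded has_field_derivative_def]])
      (intro Ck_mult Ck_add Ck_const Suc)
qed

text \<open>
  This function never reaches the value \<open>1\<close>; only its rescalings \<open>smooth_step (k x)\<close> for \<open>k \<rightarrow> \<infinity>\<close>
  are used as approximate indicator functions.
\<close>

definition smooth_step :: "real \<Rightarrow> real" where
  "smooth_step x = flat_exp 0 x"

lemma smooth_smooth_step: "smooth smooth_step"
  using Ck_flat_exp[of _ 0] by (simp add: smooth_def smooth_step_def[abs_def])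

lemma smooth_step_pos: "x > 0 \<Longrightarrow> smooth_step x > 0"
  and smooth_step_zero: "x \<le> 0 \<Longrightarrow> smooth_step x = 0"
  and smooth_step_nonneg: "0 \<le> smooth_step x"
  and smooth_step_le_1: "smooth_step x \<le> 1"
  by (auto simp: smooth_step_def flat_exp_def)

lemma smooth_step_mono: "x \<le> y \<Longrightarrow> smooth_step x \<le> smooth_step y"
  by (auto simp: smooth_step_def flat_exp_def field_simps)

lemma smooth_step_scaled_tendsto:
  "(\<lambda>k. smooth_step (real k * x - c)) \<longlonglongrightarrow> indicat_real {0<..} x" if "c \<ge> 0"
proof (cases "x > 0")
  case True
  have lim: "filterlim (\<lambda>k. real k * x - c) at_top sequentially"
    using filterlim_tendsto_add_at_top[OF tendsto_const[of "- c"]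
        filterlim_tendsto_pos_mult_at_top[OF tendsto_const True filterlim_real_sequentially]]
    by (simp add: algebra_simps)
  have "(\<lambda>k. exp (- inverse (real k * x - c))) \<longlonglongrightarrow> exp (- 0)"
    by (intro tendsto_exp tendsto_minus) (rule tendsto_inverse_0_at_top[OF lim])
  moreover have "\<forall>\<^sub>F k in sequentially. exp (- inverse (real k * x - c)) = smooth_step (real k * x - c)"
    using lim[unfolded filterlim_at_top_dense, rule_format, of 0]
    by eventually_elim (auto simp: smooth_step_def flat_exp_def field_simps)
  ultimately have "(\<lambda>k. smooth_step (real k * x - c)) \<longlonglongrightarrow> exp (-0)"
    by (rule Lim_transform_eventually)
  with True show ?thesis by simp
next
  case False
  then have "real k * x - c \<le> 0" for k
    using that by (smt (verit) mult_nonneg_nonpos of_nat_0_le_iff)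
  then show ?thesis using False by (simp add: smooth_step_zero)
qed

lemma smooth_smooth_step_compose: "smooth f \<Longrightarrow> smooth (\<lambda>x. smooth_step (f x))"
  by (rule smooth_compose[OF smooth_smooth_step])

section \<open>Compactly supported functions\<close>

lemma compact_supp_iff: "compact (supp f) \<longleftrightarrow> bounded {x::'a::euclidean_space. f x \<noteq> 0}"
  by (auto simp: supp_def compact_eq_bounded_closed bounded_closure_image dest: bounded_subset[OF _ closure_subset])

lemma test_functionI: "smooth f \<Longrightarrow> bounded {x. f x \<noteq> 0} \<Longrightarrow> test_function f"
  by (simp add: test_function_def smooth_def compact_supp_iff)

lemma test_function_smooth: "test_function f \<Longrightarrow> smooth f"
  by (simp add: test_function_def smooth_def)

lemma test_function_bounded: "test_function f \<Longrightarrow> bounded {x. f x \<noteq> 0}"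
  by (simp add: test_function_def compact_supp_iff)

lemma pderiv_dir_outside_supp:
  assumes "x \<notin> supp f"
  shows "pderiv_dir f e x = 0"
proof -
  have "((\<lambda>x. 0) has_derivative (\<lambda>_. 0)) (at x)" by simp
  then have "(f has_derivative (\<lambda>_. 0)) (at x)"
    by (rule has_derivative_transform_within_open[of _ _ _ UNIV "- supp f"])
      (use assms closure_subset[of "{x. f x \<noteq> 0}"] in \<open>auto simp: supp_def\<close>)
  then show ?thesis using pderiv_dir_eq by blast
qed

lemma bounded_pderiv_dir:
  assumes "bounded {x. f x \<noteq> 0}"
  shows "bounded {x. pderiv_dir f e x \<noteq> 0}"
  by (rule bounded_subset[of "supp f"])
    (use assms pderiv_dir_outside_supp in \<open>auto simp: supp_def\<close>)

lemma continuous_bounded_support_bounded: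
  fixes f :: "'a::euclidean_space \<Rightarrow> real"
  assumes "continuous_on UNIV f" "bounded {x. f x \<noteq> 0}"
  obtains M where "M > 0" "\<And>x. \<bar>f x\<bar> \<le> M"
proof -
  have "compact (supp f)" using assms compact_supp_iff by blast
  then have "compact (f ` supp f)"
    using assms(1) compact_continuous_image continuous_on_subset by blast
  then obtain M where M: "\<And>x. x \<in> supp f \<Longrightarrow> \<bar>f x\<bar> \<le> M" "M > 0"
    by (force simp: bounded_pos dest!: compact_imp_bounded)
  have "\<bar>f x\<bar> \<le> M" for x
    using M(1)[of x] M(2) closure_subset[of "{x. f x \<noteq> 0}"] by (cases "f x = 0") (auto simp: supp_def)
  with M that show ?thesis by blast
qed

lemma continuous_bounded_support_integrable:
  fixes f :: "'a::euclidean_space \<Rightarrow> real"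
  assumes "continuous_on UNIV f" "bounded {x. f x \<noteq> 0}"
  shows "integrable lborel f"
proof -
  have "set_integrable lborel (supp f) f"
    using assms compact_supp_iff borel_integrable_compact continuous_on_subset
    unfolding set_integrable_def by blast
  moreover have "(\<lambda>x. indicator (supp f) x *\<^sub>R f x) = f"
    using closure_subset[of "{x. f x \<noteq> 0}"] by (auto simp: supp_def indicator_def fun_eq_iff)
  ultimately show ?thesis by (simp only: set_integrable_def)
qed

section \<open>Maps that preserve Lebesgue measure\<close>

definition preserves_lborel :: "('a::euclidean_space \<Rightarrow> 'a) \<Rightarrow> bool" where
  "preserves_lborel F \<longleftrightarrow> F \<in> borel_measurable borel \<and> distr lborel borel F = lborel"

lemma preserves_lborelI:
  assumes "F \<in> borel_measurable borel"
    and "\<And>A. A \<in> sets borel \<Longrightarrow> emeasure lborel (F -` A) = emeasure lborel A"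
  shows "preserves_lborel F"
  unfolding preserves_lborel_def
  using assms by (auto intro!: measure_eqI simp: emeasure_distr)

lemma preserves_lborel_measurable: "preserves_lborel F \<Longrightarrow> F \<in> borel_measurable borel"
  by (simp add: preserves_lborel_def)

lemma preserves_lborel_emeasure:
  assumes "preserves_lborel F" "A \<in> sets borel"
  shows "emeasure lborel (F -` A) = emeasure lborel A"
  using assms emeasure_distr[of F lborel borel A] by (simp add: preserves_lborel_def)

lemma preserves_lborel_compose:
  assumes "preserves_lborel F" "preserves_lborel H"
  shows "preserves_lborel (\<lambda>x. F (H x))"
proof -
  note [measurable] = assms[THEN preserves_lborel_measurable]
  have "distr lborel borel (\<lambda>x. F (H x)) = distr (distr lborel borel H) borel F"
    by (subst distr_distr) (auto simp: comp_def)
  then show ?thesis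
    using assms by (simp add: preserves_lborel_def)
qed

lemma integral_preserves_lborel:
  fixes f :: "'a::euclidean_space \<Rightarrow> real"
  assumes "preserves_lborel F" "f \<in> borel_measurable borel"
  shows "(\<integral>x. f (F x) \<partial>lborel) = (\<integral>x. f x \<partial>lborel)"
  using integral_distr[of F lborel borel f] assms by (simp add: preserves_lborel_def)

lemma integrable_preserves_lborel:
  fixes f :: "'a::euclidean_space \<Rightarrow> real"
  assumes "preserves_lborel F" "f \<in> borel_measurable borel"
  shows "integrable lborel (\<lambda>x. f (F x)) \<longleftrightarrow> integrable lborel f"
  using integrable_distr_eq[of F lborel borel f] assms by (simp add: preserves_lborel_def)

lemma AE_preserves_lborel:
  assumes "preserves_lborel F" "{x. P x} \<in> sets borel"
  shows "(AE x in lborel. P (F x)) \<longleftrightarrow> (AE x in lborel. P x)"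
proof -
  have "F \<in> borel_measurable borel" and distr: "distr lborel borel F = lborel"
    using assms by (simp_all add: preserves_lborel_def)
  with AE_distr_iff[of F lborel borel P] assms(2) show ?thesis
    unfolding distr by simp
qed

lemma preserves_lborel_translation: "preserves_lborel (\<lambda>x. x + v)"
  using lborel_distr_plus[of v] by (simp add: preserves_lborel_def add.commute[of _ v])

text \<open>
  The level set \<open>{m = i}\<close> is invariant under \<open>H i\<close>, so the preimage of \<open>A\<close> falls apart into the
  preimages of the pieces \<open>A \<inter> {m = i}\<close>, each under a single measure preserving map.
\<close>

lemma preserves_lborel_countable_selection:
  fixes H :: "int \<Rightarrow> 'a::euclidean_space \<Rightarrow> 'a" and m :: "'a \<Rightarrow> int"
  assumes H: "\<And>i. preserves_lborel (H i)"
    and m[measurable]: "m \<in> measurable borel (count_space UNIV)"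
    and inv: "\<And>i z. m (H i z) = m z"
  shows "preserves_lborel (\<lambda>z. H (m z) z)"
proof (rule preserves_lborelI)
  note [measurable] = H[THEN preserves_lborel_measurable]
  show "(\<lambda>z. H (m z) z) \<in> borel_measurable borel"
    by (rule measurable_compose_countable[OF _ m]) measurable
  fix A :: "'a set" assume [measurable]: "A \<in> sets borel"
  define B where "B = (\<lambda>i. {z. m z = i \<and> z \<in> A})"
  have B[measurable]: "B i \<in> sets borel" for i
    unfolding B_def by measurable
  have HB[measurable]: "H i -` B i \<in> sets borel" for i
    using measurable_sets[OF preserves_lborel_measurable[OF H] B] by simp
  have "(\<lambda>z. H (m z) z) -` A = (\<Union>i. H i -` B i)"
    by (auto simp: B_def inv)
  then have "emeasure lborel ((\<lambda>z. H (m z) z) -` A) = (\<integral>\<^sup>+i. emeasure lborel (H i -` B i) \<partial>count_space UNIV)"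
    by (simp, intro emeasure_UN_countable) (auto simp: disjoint_family_on_def B_def inv HB[unfolded B_def])
  also have "\<dots> = (\<integral>\<^sup>+i. emeasure lborel (B i) \<partial>count_space UNIV)"
    using preserves_lborel_emeasure[OF H B] by simp
  also have "\<dots> = emeasure lborel (\<Union>i. B i)"
    by (intro emeasure_UN_countable[symmetric]) (use B in \<open>auto simp: disjoint_family_on_def B_def\<close>)
  also have "(\<Union>i. B i) = A" by (auto simp: B_def)
  finally show "emeasure lborel ((\<lambda>z. H (m z) z) -` A) = emeasure lborel A" .
qed

text \<open>
  Outer regularity: a Borel set is contained in open sets that exceed it by arbitrarily little measure.
\<close>

lemma emeasure_vimage_le:
  fixes F :: "'a::euclidean_space \<Rightarrow> 'a"
  assumes F[measurable]: "F \<in> borel_measurable borel"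
    and le: "\<And>U. open U \<Longrightarrow> emeasure lborel (F -` U) \<le> emeasure lborel U"
    and A[measurable]: "A \<in> sets borel"
  shows "emeasure lborel (F -` A) \<le> emeasure lborel A"
proof (rule ennreal_le_epsilon)
  fix e :: real assume "e > 0"
  then obtain U where U: "open U" "A \<subseteq> U" "emeasure lborel (U - A) < e"
    using outer_regular_lborel[OF A] by blast
  have [measurable]: "U \<in> sets borel" using U by auto
  have "emeasure lborel (F -` A) \<le> emeasure lborel (F -` U)"
    using U measurable_sets[OF F, of U] by (intro emeasure_mono) auto
  also have "\<dots> \<le> emeasure lborel (A \<union> (U - A))"
    using le[OF U(1)] U(2) by (simp add: Un_absorb1)
  also have "\<dots> \<le> emeasure lborel A + emeasure lborel (U - A)"
    by (rule emeasure_subadditive) auto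
  finally show "emeasure lborel (F -` A) \<le> emeasure lborel A + ennreal e"
    using U(3) by (meson add_left_mono less_imp_le order_trans)
qed

text \<open>
  The principle behind all changes of variables below: if the parameter \<open>\<tau> z\<close> of a one-parameter family
  of measure preserving maps is constant along the maps themselves, it may vary from point to point.
  Rounding \<open>\<tau>\<close> down to multiples of \<open>1 / k\<close> gives measure preserving maps
  that converge pointwise; by Fatou's lemma preimages of open sets, and then of all Borel sets, do not
  gain measure in the limit. The inverse map \<open>z \<mapsto> G (- \<tau> z) z\<close> has the same property, which gives equality.
\<close>

lemma preserves_lborel_selection:
  fixes G :: "real \<Rightarrow> 'a::euclidean_space \<Rightarrow> 'a"
  assumes G: "\<And>c. preserves_lborel (G c)"
    and cont: "\<And>z. continuous_on UNIV (\<lambda>c. G c z)"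
    and inverse: "\<And>c z. G (- c) (G c z) = z"
    and \<tau>[measurable]: "\<tau> \<in> borel_measurable borel"
    and inv: "\<And>c z. \<tau> (G c z) = \<tau> z"
  shows "preserves_lborel (\<lambda>z. G (\<tau> z) z)"
proof -
  have main: "(\<lambda>z. G (\<sigma> z) z) \<in> borel_measurable borel"
      "A \<in> sets borel \<Longrightarrow> emeasure lborel ((\<lambda>z. G (\<sigma> z) z) -` A) \<le> emeasure lborel A"
    if \<sigma>[measurable]: "\<sigma> \<in> borel_measurable borel" and inv: "\<And>c z. \<sigma> (G c z) = \<sigma> z" for \<sigma> A
  proof -
    \<comment> \<open>rounding down keeps the parameter invariant and leaves countably many values\<close>
    define F where "F = (\<lambda>k z. G (real_of_int \<lfloor>real (Suc k) * \<sigma> z\<rfloor> / real (Suc k)) z)"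
    have F: "preserves_lborel (F k)" for k
      unfolding F_def
      by (rule preserves_lborel_countable_selection[where H="\<lambda>i. G (real_of_int i / real (Suc k))"])
        (auto simp: inv intro!: G)
    note [measurable] = preserves_lborel_measurable[OF F]
    have "(\<lambda>k. real_of_int \<lfloor>real (Suc k) * x\<rfloor> / real (Suc k)) \<longlonglongrightarrow> x" for x
    proof (rule real_tendsto_sandwich)
      have "x - inverse n \<le> real_of_int \<lfloor>n * x\<rfloor> / n \<and> real_of_int \<lfloor>n * x\<rfloor> / n \<le> x" if "n > 0" for n
      proof -
        have "n * x - 1 \<le> real_of_int \<lfloor>n * x\<rfloor>" "real_of_int \<lfloor>n * x\<rfloor> \<le> n * x" by linarith+
        then have "(n * x - 1) / n \<le> real_of_int \<lfloor>n * x\<rfloor> / n" "real_of_int \<lfloor>n * x\<rfloor> / n \<le> n * x / n"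
          using that by (intro divide_right_mono; simp)+
        with that show ?thesis by (simp add: diff_divide_distrib inverse_eq_divide)
      qed
      from this[of "real (Suc _)"]
      show "\<forall>\<^sub>F k in sequentially. x - inverse (real (Suc k)) \<le> real_of_int \<lfloor>real (Suc k) * x\<rfloor> / real (Suc k)"
        and "\<forall>\<^sub>F k in sequentially. real_of_int \<lfloor>real (Suc k) * x\<rfloor> / real (Suc k) \<le> x"
        by (simp_all del: of_nat_Suc)
      show "(\<lambda>k. x - inverse (real (Suc k))) \<longlonglongrightarrow> x"
        using tendsto_diff[OF tendsto_const LIMSEQ_inverse_real_of_nat] by simp
      show "(\<lambda>k. x) \<longlonglongrightarrow> x" by simp
    qed
    then have lim: "(\<lambda>k. F k z) \<longlonglongrightarrow> G (\<sigma> z) z" for z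
      unfolding F_def by (rule continuous_on_tendsto_compose[OF cont]) simp_all
    show meas[measurable]: "(\<lambda>z. G (\<sigma> z) z) \<in> borel_measurable borel"
      by (rule borel_measurable_LIMSEQ_metric[OF preserves_lborel_measurable[OF F] lim])
    have "emeasure lborel ((\<lambda>z. G (\<sigma> z) z) -` U) \<le> emeasure lborel U" if "open U" for U
    proof -
      have [measurable]: "U \<in> sets borel" using that by auto
      have vU: "(\<lambda>z. G (\<sigma> z) z) -` U \<in> sets borel" "F k -` U \<in> sets borel" for k
        using measurable_sets[OF meas, of U] measurable_sets[OF preserves_lborel_measurable[OF F], of U] by auto
      have "emeasure lborel ((\<lambda>z. G (\<sigma> z) z) -` U)
          = (\<integral>\<^sup>+z. indicator ((\<lambda>z. G (\<sigma> z) z) -` U) z \<partial>lborel)"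
        using vU by simp
      also have "\<dots> \<le> (\<integral>\<^sup>+z. liminf (\<lambda>k. indicator (F k -` U) z) \<partial>lborel)"
      proof (rule nn_integral_mono)
        fix z
        show "indicator ((\<lambda>z. G (\<sigma> z) z) -` U) z \<le> (liminf (\<lambda>k. indicator (F k -` U) z) :: ennreal)"
        proof (cases "G (\<sigma> z) z \<in> U")
          case True
          have "\<forall>\<^sub>F k in sequentially. F k z \<in> U"
            using topological_tendstoD[OF lim \<open>open U\<close> True] .
          then show ?thesis
            using True by (intro Liminf_bounded) (auto elim: eventually_mono)
        qed auto
      qed
      also have "\<dots> \<le> liminf (\<lambda>k. \<integral>\<^sup>+z. indicator (F k -` U) z \<partial>lborel)"
        using vU by (intro nn_integral_liminf) auto
      also have "\<dots> = emeasure lborel U"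
        using vU preserves_lborel_emeasure[OF F, of U] by (simp add: Liminf_const)
      finally show ?thesis .
    qed
    from emeasure_vimage_le[OF meas this]
    show "A \<in> sets borel \<Longrightarrow> emeasure lborel ((\<lambda>z. G (\<sigma> z) z) -` A) \<le> emeasure lborel A" .
  qed
  note fwd = main[OF \<tau> inv]
  have bwd: "(\<lambda>z. G (- \<tau> z) z) \<in> borel_measurable borel"
      "A \<in> sets borel \<Longrightarrow> emeasure lborel ((\<lambda>z. G (- \<tau> z) z) -` A) \<le> emeasure lborel A" for A
    using main[of "\<lambda>z. - \<tau> z"] inv by auto
  show ?thesis
  proof (rule preserves_lborelI[OF fwd(1)])
    fix A :: "'a set" assume A: "A \<in> sets borel"
    have inverse': "G c (G (- c) z) = z" for c z
      using inverse[of "- c"] by simp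
    have "A = (\<lambda>z. G (- \<tau> z) z) -` (\<lambda>z. G (\<tau> z) z) -` A"
      by (auto simp: inv inverse')
    also have "emeasure lborel \<dots> \<le> emeasure lborel ((\<lambda>z. G (\<tau> z) z) -` A)"
      by (rule bwd) (use measurable_sets[OF fwd(1), of A] A in simp)
    finally show "emeasure lborel ((\<lambda>z. G (\<tau> z) z) -` A) = emeasure lborel A"
      using fwd(2)[OF A] by simp
  qed
qed

section \<open>Rotations in a coordinate plane\<close>

text \<open>
  Rotation by the angle \<open>c\<close> in the plane of the orthonormal vectors \<open>p\<close> and \<open>q\<close>, and the identity on the
  orthogonal complement of that plane. Being free of coordinates, the formula serves both for space and for
  space-time.
\<close>

definition rot :: "'a::real_inner \<Rightarrow> 'a \<Rightarrow> real \<Rightarrow> 'a \<Rightarrow> 'a" where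
  "rot p q c x = x + ((cos c - 1) * (x \<bullet> p) - sin c * (x \<bullet> q)) *\<^sub>R p
                   + (sin c * (x \<bullet> p) + (cos c - 1) * (x \<bullet> q)) *\<^sub>R q"

definition quarter_turn :: "'a::real_inner \<Rightarrow> 'a \<Rightarrow> 'a \<Rightarrow> 'a" where
  "quarter_turn p q x = (x \<bullet> p) *\<^sub>R q - (x \<bullet> q) *\<^sub>R p"

lemma rot_0: "rot p q 0 x = x"
  by (simp add: rot_def)

lemma continuous_rot: "continuous_on S (\<lambda>c. rot p q c x)"
  unfolding rot_def by (intro continuous_intros)

definition orthonormal :: "'a::real_inner \<Rightarrow> 'a \<Rightarrow> bool" where
  "orthonormal p q \<longleftrightarrow> p \<bullet> p = 1 \<and> q \<bullet> q = 1 \<and> p \<bullet> q = 0"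

context
  fixes p q :: "'a::real_inner"
  assumes pq: "orthonormal p q"
begin

lemma orthonormal_simps: "p \<bullet> p = 1" "q \<bullet> q = 1" "p \<bullet> q = 0" "q \<bullet> p = 0"
  using pq by (simp_all add: orthonormal_def inner_commute)

lemma rot_inner_p: "rot p q c x \<bullet> p = cos c * (x \<bullet> p) - sin c * (x \<bullet> q)"
  and rot_inner_q: "rot p q c x \<bullet> q = sin c * (x \<bullet> p) + cos c * (x \<bullet> q)"
  by (simp_all add: rot_def orthonormal_simps algebra_simps)

lemma rot_rot: "rot p q c (rot p q d x) = rot p q (c + d) x"
  unfolding rot_def[of p q c] rot_inner_p rot_inner_q
  unfolding rot_def by (simp add: cos_add sin_add algebra_simps)

lemma rot_minus: "rot p q (- c) (rot p q c x) = x"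
  by (simp add: rot_rot rot_0)

lemma rot_inner_self: "rot p q c x \<bullet> rot p q c x = x \<bullet> x"
proof -
  have sc: "sin c * sin c = 1 - cos c * cos c"
    using sin_cos_squared_add[of c] by (simp add: power2_eq_square)
  have expand: "y \<bullet> rot p q c x = y \<bullet> x + ((cos c - 1) * (x \<bullet> p) - sin c * (x \<bullet> q)) * (y \<bullet> p)
      + (sin c * (x \<bullet> p) + (cos c - 1) * (x \<bullet> q)) * (y \<bullet> q)" for y
    by (simp add: rot_def inner_add_right)
  have alg: "(k - 1) * a * a - s * b * a + (s * a * b + (k - 1) * b * b)
      + ((k - 1) * a - s * b) * (k * a - s * b) + (s * a + (k - 1) * b) * (s * a + k * b) = 0"
    if "s * s = 1 - k * k" for a b k s :: real
    using that by algebra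
  have "rot p q c x \<bullet> rot p q c x = x \<bullet> rot p q c x
      + ((cos c - 1) * (x \<bullet> p) - sin c * (x \<bullet> q)) * (rot p q c x \<bullet> p)
      + (sin c * (x \<bullet> p) + (cos c - 1) * (x \<bullet> q)) * (rot p q c x \<bullet> q)"
    by (subst expand) (simp add: inner_commute)
  also have "\<dots> = x \<bullet> x"
    unfolding rot_inner_p rot_inner_q expand
    using alg[OF sc, of "x \<bullet> p" "x \<bullet> q"] by (simp add: algebra_simps)
  finally show ?thesis .
qed

lemma quarter_turn_rot:
  "quarter_turn p q (rot p q c x)
     = (cos c * (x \<bullet> p) - sin c * (x \<bullet> q)) *\<^sub>R q - (sin c * (x \<bullet> p) + cos c * (x \<bullet> q)) *\<^sub>R p"
  by (simp add: quarter_turn_def rot_inner_p rot_inner_q)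

lemma rot_has_vector_derivative:
  "((\<lambda>t. rot p q (t * w) x) has_vector_derivative w *\<^sub>R quarter_turn p q (rot p q (t * w) x)) (at t within S)"
  unfolding rot_def[of p q _ x] quarter_turn_rot
  by (auto intro!: derivative_eq_intros simp: algebra_simps quarter_turn_def orthonormal_simps)

end

text \<open>
  A shear is a translation in direction \<open>p\<close> by an amount that translations in direction \<open>p\<close> do not change.
\<close>

lemma preserves_lborel_shear:
  fixes p q :: "'a::euclidean_space"
  assumes "p \<bullet> q = 0"
  shows "preserves_lborel (\<lambda>x. x + (a * (x \<bullet> q)) *\<^sub>R p)"
  by (rule preserves_lborel_selection[where G="\<lambda>c x. x + c *\<^sub>R p"])
    (auto simp: preserves_lborel_translation inner_add_left assms intro!: continuous_intros)

text \<open>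
  A planar rotation by \<open>c\<close> is the product of three shears, with coefficients \<open>- tan (c / 2)\<close>, \<open>sin c\<close> and
  \<open>- tan (c / 2)\<close>. For odd multiples of \<open>\<pi>\<close>, where the tangent has a pole, rotate twice by half the angle.
\<close>

lemma preserves_lborel_rot:
  fixes p q :: "'a::euclidean_space"
  assumes pq: "orthonormal p q"
  shows "preserves_lborel (rot p q c)"
proof -
  note [simp] = orthonormal_simps[OF pq]
  have shears: "preserves_lborel (rot p q c)" if "cos (c / 2) \<noteq> 0" for c
  proof -
    define t s where "t = tan (c / 2)" and "s = sin c"
    have ts: "t * s = 1 - cos c"
      using cos_double_sin[of "c/2"] sin_double[of "c/2"] that
      by (simp add: t_def s_def tan_def power2_eq_square field_simps)
    have "t * (1 + cos c) = s"
      using cos_double_cos[of "c/2"] sin_double[of "c/2"] that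
      by (simp add: t_def s_def tan_def power2_eq_square field_simps)
    then have t2: "t * cos c = s - t" by (simp add: algebra_simps)
    define F where "F = (\<lambda>x. x + ((- t) * (x \<bullet> q)) *\<^sub>R p)"
    define H where "H = (\<lambda>x. x + (s * (x \<bullet> p)) *\<^sub>R q)"
    have "preserves_lborel F" "preserves_lborel H"
      unfolding F_def H_def by (intro preserves_lborel_shear, simp)+
    then have "preserves_lborel (\<lambda>x. F (H (F x)))"
      using preserves_lborel_compose[of F "\<lambda>x. H (F x)"] preserves_lborel_compose[of H F] by blast
    moreover have "F (H (F x)) = rot p q c x" for x
    proof -
      have "F (H (F x)) = x + ((- t * s) * (x \<bullet> p) + (t * (t * s) - t - t) * (x \<bullet> q)) *\<^sub>R p
          + (s * (x \<bullet> p) - (t * s) * (x \<bullet> q)) *\<^sub>R q"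
        by (simp add: F_def H_def algebra_simps) (simp flip: scaleR_left_distrib)
      also have "\<dots> = rot p q c x"
        unfolding ts minus_mult_left[symmetric] by (simp add: ts t2 rot_def s_def algebra_simps)
      finally show ?thesis .
    qed
    ultimately show ?thesis by (simp only:)
  qed
  show ?thesis
  proof (cases "cos (c / 2) = 0")
    case True
    then have "cos (c / 2 / 2) \<noteq> 0"
      using cos_double_cos[of "c / 2 / 2"] by auto
    then have "preserves_lborel (\<lambda>x. rot p q (c / 2) (rot p q (c / 2) x))"
      using preserves_lborel_compose[OF shears shears] by blast
    then show ?thesis by (simp add: rot_rot[OF pq])
  qed (rule shears)
qed

text \<open>
  The rotation angle may depend on any quantity that the rotations leave invariant, such as the distance to the
  origin.
\<close>

lemma preserves_lborel_twist:
  fixes p q :: "'a::euclidean_space"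
  assumes pq: "orthonormal p q" and "\<tau> \<in> borel_measurable borel" "\<And>c x. \<tau> (rot p q c x) = \<tau> x"
  shows "preserves_lborel (\<lambda>x. rot p q (\<tau> x) x)"
  by (rule preserves_lborel_selection[where G="rot p q"])
    (use assms in \<open>simp_all add: preserves_lborel_rot continuous_rot rot_minus\<close>)

section \<open>Integration by parts\<close>

lemma Ck_1_line_derivative:
  assumes "Ck 1 f"
  shows "((\<lambda>s. f (x + s *\<^sub>R e)) has_real_derivative pderiv_dir f e (x + s *\<^sub>R e)) (at s)"
proof -
  have f: "(f has_derivative (\<lambda>e. pderiv_dir f e y)) (at y)" for y
    using assms Ck_has_derivative[of 0 f] by simp
  have "((\<lambda>s. x + s *\<^sub>R e) has_vector_derivative e) (at s)"
    by (auto intro!: derivative_eq_intros)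
  from vector_derivative_diff_chain_within[OF this has_derivative_at_withinI[OF f]]
  show ?thesis by (simp add: has_real_derivative_iff_has_vector_derivative comp_def)
qed

text \<open>
  By translation invariance the integrals of all difference quotients of \<open>g\<close> vanish. By the mean value theorem the
  difference quotients are bounded by a bound for the derivative, so the integrals converge.
\<close>

lemma integral_pderiv_dir_eq_0:
  fixes g :: "'a::euclidean_space \<Rightarrow> real"
  assumes g: "Ck 1 g" and supp: "bounded {x. g x \<noteq> 0}" and e: "e \<in> Basis"
  shows "(\<integral>x. pderiv_dir g e x \<partial>lborel) = 0"
proof -
  have g_cont: "continuous_on UNIV g" using Ck_continuous[OF g] .
  have D_cont: "continuous_on UNIV (pderiv_dir g e)" using g e by simp
  note [measurable] = borel_measurable_continuous_onI[OF g_cont] borel_measurable_continuous_onI[OF D_cont]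
  obtain M where M: "M > 0" "\<And>x. \<bar>pderiv_dir g e x\<bar> \<le> M"
    using continuous_bounded_support_bounded[OF D_cont bounded_pderiv_dir[OF supp]] by blast
  obtain R where R: "\<And>x. g x \<noteq> 0 \<Longrightarrow> norm x \<le> R"
    using supp by (auto simp: bounded_iff)
  define h where "h = (\<lambda>n. inverse (real (Suc n)))"
  have h: "0 < h n" "h n \<le> 1" for n
    by (auto simp: h_def field_simps)
  define s where "s = (\<lambda>n x. (g (x + h n *\<^sub>R e) - g x) / h n)"
  have "(\<lambda>n. \<integral>x. s n x \<partial>lborel) \<longlonglongrightarrow> (\<integral>x. pderiv_dir g e x \<partial>lborel)"
  proof (rule integral_dominated_convergence)
    show "integrable lborel (\<lambda>x::'a. M * indicat_real (cball 0 (R + 1)) x)"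
      using emeasure_lborel_cball_finite[of "0::'a" "R + 1"]
      by (intro integrable_mult_right) (auto intro!: integrable_real_indicator)
    show "AE x in lborel. norm (s n x) \<le> M * indicat_real (cball 0 (R + 1)) x" for n
    proof (rule AE_I2)
      fix x
      show "norm (s n x) \<le> M * indicat_real (cball 0 (R + 1)) x"
      proof (cases "norm x \<le> R + 1")
        case True
        obtain z where "g (x + h n *\<^sub>R e) - g (x + 0 *\<^sub>R e) = (h n - 0) * pderiv_dir g e (x + z *\<^sub>R e)"
          using MVT2[of 0 "h n" "\<lambda>s. g (x + s *\<^sub>R e)" "\<lambda>s. pderiv_dir g e (x + s *\<^sub>R e)"]
            h Ck_1_line_derivative[OF g] by blast
        then have "s n x = pderiv_dir g e (x + z *\<^sub>R e)"
          using h(1)[of n] by (simp add: s_def)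
        with True M(2) show ?thesis by simp
      next
        case False
        have "norm x \<le> norm (x + h n *\<^sub>R e) + norm (h n *\<^sub>R e)"
          by (metis add_diff_cancel_right' norm_triangle_ineq4)
        then have "norm x \<le> norm (x + h n *\<^sub>R e) + 1"
          using e h[of n] by simp
        with False have "g (x + h n *\<^sub>R e) = 0" "g x = 0"
          using R[of x] R[of "x + h n *\<^sub>R e"] by fastforce+
        with False show ?thesis by (simp add: s_def)
      qed
    qed
    show "AE x in lborel. (\<lambda>n. s n x) \<longlonglongrightarrow> pderiv_dir g e x"
    proof (rule AE_I2)
      fix x
      have "((\<lambda>y. (g (x + y *\<^sub>R e) - g x) / y) \<longlongrightarrow> pderiv_dir g e x) (at 0)"
        using Ck_1_line_derivative[OF g, of x e 0] by (simp add: has_field_derivative_iff)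
      moreover have "filterlim h (at 0) sequentially"
        using h LIMSEQ_inverse_real_of_nat
        by (auto simp: filterlim_at h_def intro!: always_eventually simp del: of_nat_Suc)
      ultimately show "(\<lambda>n. s n x) \<longlonglongrightarrow> pderiv_dir g e x"
        unfolding s_def by (rule filterlim_compose)
    qed
  qed (auto simp: s_def)
  moreover have "(\<integral>x. s n x \<partial>lborel) = 0" for n
  proof -
    have int: "integrable lborel g"
      by (rule continuous_bounded_support_integrable[OF g_cont supp])
    have "(\<integral>x. g (x + h n *\<^sub>R e) \<partial>lborel) = (\<integral>x. g x \<partial>lborel)"
      by (rule integral_preserves_lborel[OF preserves_lborel_translation]) simp
    moreover have "integrable lborel (\<lambda>x. g (x + h n *\<^sub>R e))"
      using int by (subst integrable_preserves_lborel[OF preserves_lborel_translation]) auto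
    ultimately show ?thesis using int by (simp add: s_def)
  qed
  ultimately show ?thesis
    by (simp add: LIMSEQ_const_iff)
qed

lemma integral_by_parts:
  fixes f \<phi> :: "'a::euclidean_space \<Rightarrow> real"
  assumes f: "Ck 1 f" and \<phi>: "test_function \<phi>" and e: "e \<in> Basis"
  shows "(\<integral>x. f x * pderiv_dir \<phi> e x \<partial>lborel) = - (\<integral>x. pderiv_dir f e x * \<phi> x \<partial>lborel)"
proof -
  have \<phi>1: "Ck 1 \<phi>" using test_function_smooth[OF \<phi>] by (simp add: smooth_def)
  have D: "(f has_derivative (\<lambda>e. pderiv_dir f e y)) (at y)" "(\<phi> has_derivative (\<lambda>e. pderiv_dir \<phi> e y)) (at y)" for y
    using f \<phi>1 Ck_has_derivative[of 0] by simp_all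
  have cont: "continuous_on UNIV f" "continuous_on UNIV \<phi>" "continuous_on UNIV (pderiv_dir f e)"
      "continuous_on UNIV (pderiv_dir \<phi> e)"
    using Ck_continuous[OF f] Ck_continuous[OF \<phi>1] f \<phi>1 e by simp_all
  note supp = test_function_bounded[OF \<phi>]
  have "integrable lborel (\<lambda>x. f x * pderiv_dir \<phi> e x)"
    using cont bounded_pderiv_dir[OF supp, of e]
    by (intro continuous_bounded_support_integrable continuous_intros) (auto elim: bounded_subset)
  moreover have "integrable lborel (\<lambda>x. pderiv_dir f e x * \<phi> x)"
    using cont supp
    by (intro continuous_bounded_support_integrable continuous_intros) (auto elim: bounded_subset)
  moreover have "(\<integral>x. pderiv_dir (\<lambda>x. f x * \<phi> x) e x \<partial>lborel) = 0"
    using Ck_mult[OF f \<phi>1] supp e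
    by (intro integral_pderiv_dir_eq_0) (auto elim: bounded_subset)
  moreover have "pderiv_dir (\<lambda>x. f x * \<phi> x) e x = f x * pderiv_dir \<phi> e x + pderiv_dir f e x * \<phi> x" for x
    by (rule pderiv_dir_eq[OF has_derivative_mult[OF D]])
  ultimately show ?thesis by simp
qed

lemma locally_integrable_times_test:
  fixes g :: "real^'n \<Rightarrow> real^'n"
  assumes g: "locally_integrable UNIV g" and \<phi>: "continuous_on UNIV \<phi>" "bounded {x. \<phi> x \<noteq> 0}"
  shows "integrable lborel (\<lambda>x. g x $ i * \<phi> x)"
proof -
  obtain M where M: "M > 0" "\<And>x. \<bar>\<phi> x\<bar> \<le> M"
    using continuous_bounded_support_bounded[OF \<phi>] by blast
  have "compact (supp \<phi>)" using \<phi> compact_supp_iff by blast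
  then have int: "integrable lborel (\<lambda>x. indicator (supp \<phi>) x *\<^sub>R g x)"
    using g by (auto simp: locally_integrable_def set_integrable_def)
  have eq: "(\<lambda>x. g x $ i * \<phi> x) = (\<lambda>x. (indicator (supp \<phi>) x *\<^sub>R g x) $ i * \<phi> x)"
    using closure_subset[of "{x. \<phi> x \<noteq> 0}"] by (auto simp: supp_def indicator_def fun_eq_iff)
  have [measurable]: "\<phi> \<in> borel_measurable borel"
    using \<phi>(1) by (rule borel_measurable_continuous_onI)
  have comp: "integrable lborel (\<lambda>x. (indicator (supp \<phi>) x *\<^sub>R g x) \<bullet> axis i 1)"
    using int by (rule integrable_inner_left)
  show ?thesis
    unfolding eq
  proof (rule Bochner_Integration.integrable_bound)
    show "integrable lborel (\<lambda>x. M * ((indicator (supp \<phi>) x *\<^sub>R g x) \<bullet> axis i 1))"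
      using comp by simp
    show "(\<lambda>x. (indicator (supp \<phi>) x *\<^sub>R g x) $ i * \<phi> x) \<in> borel_measurable lborel"
      using borel_measurable_integrable[OF comp] by (intro borel_measurable_times) (auto simp: inner_axis)
    show "AE x in lborel. norm ((indicator (supp \<phi>) x *\<^sub>R g x) $ i * \<phi> x)
        \<le> norm (M * ((indicator (supp \<phi>) x *\<^sub>R g x) \<bullet> axis i 1))"
      using M by (auto simp: inner_axis abs_mult mult.commute[of M] intro!: mult_left_mono)
  qed
qed

text \<open>
  A bounded weak gradient bounds the classical partial derivatives wherever the function is locally of class
  \<open>C\<^sup>1\<close>: if a partial derivative of \<open>F\<close> exceeded \<open>K\<close> in absolute value at \<open>x0\<close>, it would do so on a small ball, and testing with a
  bump on that ball gives the same integral for \<open>g\<close> as for the larger classical derivative.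
\<close>

lemma weak_gradient_bound_imp_pderiv_bound:
  fixes f :: "real^'n \<Rightarrow> real"
  assumes wg: "weak_gradient f g" and K: "AE x in lborel. norm (g x) \<le> K"
    and F: "Ck 1 F" and r: "r > 0" and eq: "\<And>x. x \<in> ball x0 r \<Longrightarrow> f x = F x"
  shows "\<bar>pderiv_dir F (axis i 1) x0\<bar> \<le> K"
proof (rule ccontr)
  define D where "D = pderiv_dir F (axis i 1)"
  define \<sigma> where "\<sigma> = sgn (D x0)"
  assume "\<not> \<bar>pderiv_dir F (axis i 1) x0\<bar> \<le> K"
  then have "\<sigma> * D x0 > K" by (simp add: D_def \<sigma>_def abs_sgn mult.commute)
  have e: "(axis i 1 :: real^'n) \<in> Basis" by simp
  have cont: "continuous_on UNIV F" "continuous_on UNIV D"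
    using Ck_continuous[OF F] F e by (simp_all add: D_def)
  have "open ((\<lambda>x. \<sigma> * D x) -` {K<..})"
    using cont by (intro open_vimage continuous_intros) auto
  then obtain d where d: "d > 0" "ball x0 d \<subseteq> (\<lambda>x. \<sigma> * D x) -` {K<..}"
    using \<open>\<sigma> * D x0 > K\<close> by (metis greaterThan_iff openE vimageI2)
  define \<delta> where "\<delta> = min d r / 2"
  have \<delta>: "\<delta> > 0" "\<delta> < d" "\<delta> < r" using d r by (auto simp: \<delta>_def min_def)
  define \<phi> where "\<phi> = (\<lambda>x. smooth_step (\<delta>\<^sup>2 - (norm (x - x0))\<^sup>2))"
  have \<phi>_pos: "\<phi> x > 0" if "x \<in> ball x0 \<delta>" for x
    using that \<delta> by (auto simp: \<phi>_def dist_norm norm_minus_commute power_mono intro!: smooth_step_pos power_strict_mono)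
  have \<phi>_out: "\<phi> x = 0" if "x \<notin> ball x0 \<delta>" for x
    using that \<delta> by (auto simp: \<phi>_def dist_norm norm_minus_commute intro!: smooth_step_zero power_mono)
  have \<phi>_nonneg: "\<phi> x \<ge> 0" for x by (simp add: \<phi>_def smooth_step_nonneg)
  have sm: "smooth \<phi>"
  proof -
    have "(norm (x - x0))\<^sup>2 = (\<Sum>b\<in>Basis. (x \<bullet> b - x0 \<bullet> b) * (x \<bullet> b - x0 \<bullet> b))" for x
      by (subst power2_norm_eq_inner, subst euclidean_inner) (simp add: inner_diff_left)
    then show ?thesis unfolding \<phi>_def
      by (simp only:) (intro smooth_smooth_step_compose smooth_diff smooth_sum smooth_mult smooth_const smooth_inner)
  qed
  have sub: "{x. \<phi> x \<noteq> 0} \<subseteq> ball x0 \<delta>" using \<phi>_out by blast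
  then have bd: "bounded {x. \<phi> x \<noteq> 0}" by (rule bounded_subset[OF bounded_ball])
  then have test: "test_function \<phi>" by (rule test_functionI[OF sm]) 
  have supp_sub: "supp \<phi> \<subseteq> cball x0 \<delta>"
    using closure_mono[OF sub] \<delta> by (simp add: supp_def closure_ball)
  have "(\<integral>x. g x $ i * \<phi> x \<partial>lborel) = - (\<integral>x. f x * pderiv_dir \<phi> (axis i 1) x \<partial>lborel)"
    using wg test by (simp add: weak_gradient_def)
  also have "(\<integral>x. f x * pderiv_dir \<phi> (axis i 1) x \<partial>lborel) = (\<integral>x. F x * pderiv_dir \<phi> (axis i 1) x \<partial>lborel)"
  proof (rule arg_cong[where f="integral\<^sup>L lborel"], rule ext)
    fix x
    show "f x * pderiv_dir \<phi> (axis i 1) x = F x * pderiv_dir \<phi> (axis i 1) x"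
      using eq[of x] pderiv_dir_outside_supp[of x \<phi>] supp_sub \<delta>
      by (cases "x \<in> ball x0 r") (auto simp: subset_iff, meson le_less_trans)
  qed
  also have "\<dots> = - (\<integral>x. D x * \<phi> x \<partial>lborel)"
    unfolding D_def by (rule integral_by_parts[OF F test e])
  finally have same: "(\<integral>x. g x $ i * \<phi> x \<partial>lborel) = (\<integral>x. D x * \<phi> x \<partial>lborel)" by simp
  have \<phi>_cont: "continuous_on UNIV \<phi>" using sm by (rule smooth_continuous)
  have int: "integrable lborel (\<lambda>x. g x $ i * \<phi> x)"
    using wg \<phi>_cont bd by (intro locally_integrable_times_test) (auto simp: weak_gradient_def)
  have int': "integrable lborel (\<lambda>x. D x * \<phi> x)"
    using cont \<phi>_cont bd
    by (intro continuous_bounded_support_integrable continuous_intros) (auto elim: bounded_subset)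
  define W where "W = (\<lambda>x. \<sigma> * (D x * \<phi> x) - \<sigma> * (g x $ i * \<phi> x))"
  have W_pos: "AE x in lborel. x \<in> ball x0 \<delta> \<longrightarrow> W x > 0"
    using K
  proof eventually_elim
    case (elim x)
    show ?case
    proof
      assume x: "x \<in> ball x0 \<delta>"
      then have "x \<in> ball x0 d" using \<delta> by auto
      with d have "\<sigma> * D x > K" by auto
      moreover have "\<bar>g x $ i\<bar> \<le> K" using component_le_norm_cart[of "g x" i] elim by linarith
      then have "\<sigma> * g x $ i \<le> K" unfolding \<sigma>_def by (auto simp: sgn_if)
      ultimately have "(\<sigma> * D x - \<sigma> * g x $ i) * \<phi> x > 0"
        using \<phi>_pos[OF x] by simp
      then show "W x > 0" by (simp add: W_def algebra_simps)
    qed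
  qed
  have "integrable lborel W" unfolding W_def using int int' by simp
  moreover have "AE x in lborel. 0 \<le> W x"
    using W_pos by eventually_elim (use \<phi>_out in \<open>fastforce simp: W_def\<close>)
  moreover have "integral\<^sup>L lborel W = 0"
    using int int' same by (simp add: W_def)
  ultimately have "AE x in lborel. W x = 0"
    using integral_nonneg_eq_0_iff_AE by blast
  with W_pos have "AE x in lborel. x \<notin> ball x0 \<delta>"
    by eventually_elim auto
  then have "emeasure lborel (ball x0 \<delta>) = 0"
    by (simp add: AE_iff_measurable[OF _ refl] ball_def)
  with \<delta> show False
    by (simp add: emeasure_ball) (metis less_irrefl of_nat_0_le_iff unit_ball_vol_pos)
qed

section \<open>The angular speed of the vortex\<close>

definition bump :: "real \<Rightarrow> real" where
  "bump z = smooth_step (z - 1/4) * smooth_step (1 - z)"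

abbreviation bump' :: "real \<Rightarrow> real" where
  "bump' \<equiv> pderiv_dir bump 1"

lemma smooth_bump: "smooth bump"
  unfolding bump_def[abs_def] by (intro smooth_mult smooth_smooth_step_compose smooth_diff smooth_ident smooth_const)

lemma bump_nonneg: "0 \<le> bump z" and bump_le_1: "bump z \<le> 1"
  by (auto simp: bump_def smooth_step_nonneg smooth_step_le_1 intro!: mult_le_one)

lemma bump_outside: "z \<le> 1/4 \<or> 1 \<le> z \<Longrightarrow> bump z = 0"
  by (auto simp: bump_def smooth_step_zero)

lemma bump_has_derivative: "(bump has_real_derivative bump' z) (at z)"
  by (rule smooth_has_real_derivative[OF smooth_bump])

text \<open>
  At each of these points the nonnegative function \<open>bump\<close> attains its minimum \<open>0\<close>.
\<close>

lemma bump'_outside: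
  assumes "z \<le> 1/4 \<or> 1 \<le> z"
  shows "bump' z = 0"
  using DERIV_local_min[OF bump_has_derivative[of z] zero_less_one] bump_nonneg bump_outside[OF assms]
  by auto

lemma bump'_nonzero: obtains z where "1/4 < z" "z < 1" "bump' z \<noteq> 0"
proof -
  obtain z where z: "1/4 < z" "z < 1/2" "bump (1/2) - bump (1/4) = (1/2 - 1/4) * bump' z"
    using MVT2[of "1/4" "1/2" bump bump'] bump_has_derivative by fastforce
  moreover have "bump (1/2) > 0" by (simp add: bump_def smooth_step_pos)
  ultimately have "bump' z \<noteq> 0" using bump_outside[of "1/4"] by auto
  with z that show ?thesis by auto
qed

lemma bump'_bounded: obtains B where "B > 0" "\<And>z. \<bar>bump' z\<bar> \<le> B"
proof -
  have "bump z \<noteq> 0 \<Longrightarrow> 1/4 \<le> z \<and> z \<le> 1" for z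
    using bump_outside[of z] by linarith
  then have "bounded {z. bump z \<noteq> 0}"
    by (auto intro!: bounded_subset[OF bounded_closed_interval[of "1/4" 1]])
  then have "bounded {z. bump' z \<noteq> 0}" by (rule bounded_pderiv_dir)
  moreover have "continuous_on UNIV bump'"
    by (rule smooth_continuous[OF smooth_pderiv_dir[OF smooth_bump]]) simp
  ultimately show ?thesis
    using continuous_bounded_support_bounded[of bump'] that by blast
qed

text \<open>
  Vortices are described by an angular speed that is a function of \<open>s = \<bar>x\<bar>\<^sup>2\<close>, since the square of the norm is
  smooth at the origin. The \<open>n\<close>-th shell is \<open>\<rho> n / 4 < s < \<rho> n\<close>; since \<open>\<rho>\<close> decreases at least by the factor \<open>4\<close> from one
  index to the next, the shells are disjoint. In shell \<open>n\<close> the speed is \<open>n\<close> times a fixed bump, rescaled to the shell. Then \<open>s\<close> times the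
  derivative of the speed is of order \<open>n\<close> however small \<open>\<rho> n\<close> is: the amplitude of the velocity gradient and the
  volume on which it lives can be chosen independently.
\<close>

locale shells =
  fixes \<rho> :: "nat \<Rightarrow> real"
  assumes \<rho>_pos: "\<rho> n > 0" and \<rho>_quarter: "\<rho> (Suc n) \<le> \<rho> n / 4"
begin

definition speed :: "real \<Rightarrow> real" where
  "speed s = (\<Sum>n. real n * bump (s / \<rho> n))"

definition speed' :: "real \<Rightarrow> real" where
  "speed' s = (\<Sum>n. real n / \<rho> n * bump' (s / \<rho> n))"

text \<open>
  Only finitely many shells are kept, so that the speed vanishes near the origin and is smooth.
\<close>

definition cut_speed :: "nat \<Rightarrow> real \<Rightarrow> real" where
  "cut_speed N s = (\<Sum>n<N. real n * bump (s / \<rho> n))"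

definition cut_speed' :: "nat \<Rightarrow> real \<Rightarrow> real" where
  "cut_speed' N s = (\<Sum>n<N. real n / \<rho> n * bump' (s / \<rho> n))"

lemma \<rho>_antimono: "m \<le> n \<Longrightarrow> \<rho> n \<le> \<rho> m"
proof (induction n rule: dec_induct)
  case (step n)
  then show ?case using \<rho>_quarter[of n] \<rho>_pos[of n] by linarith
qed simp

lemma bump_scaled_outside:
  assumes "s \<le> \<rho> n / 4 \<or> \<rho> n \<le> s"
  shows "bump (s / \<rho> n) = 0" "bump' (s / \<rho> n) = 0"
proof -
  have "s / \<rho> n \<le> 1/4 \<or> 1 \<le> s / \<rho> n"
    using assms \<rho>_pos[of n] by (auto simp: field_simps)
  then show "bump (s / \<rho> n) = 0" "bump' (s / \<rho> n) = 0"
    using bump_outside bump'_outside by blast+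
qed

lemma single_shell:
  obtains m where "\<And>n. n \<noteq> m \<Longrightarrow> s \<le> \<rho> n / 4 \<or> \<rho> n \<le> s"
proof -
  have "s \<le> \<rho> n / 4 \<or> \<rho> n \<le> s" if "\<rho> m / 4 < s" "s < \<rho> m" "n \<noteq> m" for m n
  proof (cases "n < m")
    case True
    then have "\<rho> m \<le> \<rho> n / 4" using \<rho>_antimono[of "Suc n" m] \<rho>_quarter[of n] by simp
    with that show ?thesis by simp
  next
    case False
    with that have "\<rho> n \<le> \<rho> m / 4" using \<rho>_antimono[of "Suc m" n] \<rho>_quarter[of m] by simp
    with that show ?thesis by simp
  qed
  with that show ?thesis by (meson not_le)
qed

lemma speed_cases:
  obtains m where "speed s = real m * bump (s / \<rho> m)" "speed' s = real m / \<rho> m * bump' (s / \<rho> m)"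
    "\<And>N. cut_speed N s = (if m < N then speed s else 0)"
    "\<And>N. cut_speed' N s = (if m < N then speed' s else 0)"
    "(speed s = 0 \<and> speed' s = 0) \<or> (\<rho> m / 4 < s \<and> s < \<rho> m)"
proof -
  obtain m where m: "\<And>n. n \<noteq> m \<Longrightarrow> s \<le> \<rho> n / 4 \<or> \<rho> n \<le> s"
    using single_shell by blast
  note out = bump_scaled_outside[OF m]
  have 1: "speed s = real m * bump (s / \<rho> m)" "speed' s = real m / \<rho> m * bump' (s / \<rho> m)"
    unfolding speed_def speed'_def using out
    by (subst suminf_finite[of "{m}"]; simp)+
  have 2: "cut_speed N s = (if m < N then speed s else 0)"
    "cut_speed' N s = (if m < N then speed' s else 0)" for N
    unfolding 1 cut_speed_def cut_speed'_def
    using sum.mono_neutral_right[of "{..<N}" "{m} \<inter> {..<N}" "\<lambda>n. real n * bump (s / \<rho> n)"]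
      sum.mono_neutral_right[of "{..<N}" "{m} \<inter> {..<N}" "\<lambda>n. real n / \<rho> n * bump' (s / \<rho> n)"] out
    by auto
  have 3: "(speed s = 0 \<and> speed' s = 0) \<or> (\<rho> m / 4 < s \<and> s < \<rho> m)"
    using 1 bump_scaled_outside[of s m] by auto
  show ?thesis using that[OF 1 2 3] .
qed

text \<open>
  At a given radius at most one shell is active, so truncation is all or nothing. Hence every truncated quantity is
  dominated by the full one, which serves as majorant in the limit.
\<close>

lemma cut_speed_eq_speed_or_0:
  "cut_speed N s = speed s \<and> cut_speed' N s = speed' s \<or> cut_speed N s = 0 \<and> cut_speed' N s = 0"
  by (rule speed_cases[of s]) auto

lemma eventually_cut_speed:
  "\<forall>\<^sub>F N in sequentially. cut_speed N s = speed s \<and> cut_speed' N s = speed' s"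
proof (rule speed_cases[of s])
  fix m
  assume "\<And>N. cut_speed N s = (if m < N then speed s else 0)"
    "\<And>N. cut_speed' N s = (if m < N then speed' s else 0)"
  then show ?thesis by (intro eventually_mono[OF eventually_gt_at_top[of m]]) simp
qed

lemma cut_speed_eq_speed:
  assumes "\<rho> N \<le> s"
  shows "cut_speed N s = speed s"
proof (rule speed_cases[of s])
  fix m
  assume *: "cut_speed N s = (if m < N then speed s else 0)" for N
  assume "(speed s = 0 \<and> speed' s = 0) \<or> (\<rho> m / 4 < s \<and> s < \<rho> m)"
  then have "m < N \<or> speed s = 0"
    using assms \<rho>_antimono[of N m] by fastforce
  with * show ?thesis by auto
qed

lemma speed_outside: "\<rho> 0 \<le> s \<Longrightarrow> speed s = 0 \<and> speed' s = 0"
proof (rule speed_cases[of s])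
  fix m
  assume "\<rho> 0 \<le> s" "(speed s = 0 \<and> speed' s = 0) \<or> (\<rho> m / 4 < s \<and> s < \<rho> m)"
  then show ?thesis using \<rho>_antimono[of 0 m] by auto
qed

lemma smooth_cut_speed: "smooth (cut_speed N)"
proof -
  have "smooth (\<lambda>s. s / \<rho> n)" for n
    using smooth_mult[OF smooth_ident smooth_const[of "1 / \<rho> n"]] by simp
  then show ?thesis
    unfolding cut_speed_def[abs_def]
    by (intro smooth_sum smooth_mult smooth_const smooth_compose[OF smooth_bump])
qed

lemma cut_speed_has_derivative: "(cut_speed N has_real_derivative cut_speed' N s) (at s)"
  unfolding cut_speed_def[abs_def] cut_speed'_def
proof (rule DERIV_sum)
  fix n
  have "((\<lambda>s. s / \<rho> n) has_real_derivative 1 / \<rho> n) (at s)"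
    using \<rho>_pos[of n] by (auto intro!: derivative_eq_intros)
  from DERIV_cmult[OF DERIV_chain2[OF bump_has_derivative this], of "real n"]
  show "((\<lambda>s. real n * bump (s / \<rho> n)) has_real_derivative real n / \<rho> n * bump' (s / \<rho> n)) (at s)"
    by (simp add: mult.commute)
qed

lemma borel_measurable_speed [measurable]: "speed \<in> borel_measurable borel"
  and borel_measurable_speed' [measurable]: "speed' \<in> borel_measurable borel"
proof -
  have [measurable]: "bump \<in> borel_measurable borel" "bump' \<in> borel_measurable borel"
    using smooth_bump smooth_pderiv_dir[of bump 1]
    by (auto intro!: borel_measurable_continuous_onI smooth_continuous)
  show "speed \<in> borel_measurable borel" "speed' \<in> borel_measurable borel"
    unfolding speed_def[abs_def] speed'_def[abs_def] by measurable
qed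

text \<open>
  In shell \<open>m\<close> the factor \<open>1 / \<rho> m\<close> in the derivative of the speed is compensated by \<open>s < \<rho> m\<close>.
\<close>

lemma speed_bound:
  assumes B: "\<And>z. \<bar>bump' z\<bar> \<le> B" and s: "s \<ge> 0"
  obtains m where "\<bar>speed s\<bar> \<le> real m" "\<bar>speed s\<bar> + 2 * s * \<bar>speed' s\<bar> \<le> (1 + 2 * B) * real m"
    "speed s = 0 \<and> speed' s = 0 \<or> s < \<rho> m"
proof (rule speed_cases[of s])
  fix m
  assume 1: "speed s = real m * bump (s / \<rho> m)" "speed' s = real m / \<rho> m * bump' (s / \<rho> m)"
    and 2: "(speed s = 0 \<and> speed' s = 0) \<or> (\<rho> m / 4 < s \<and> s < \<rho> m)"
  have "B \<ge> 0" using B[of 0] by linarith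
  have le: "\<bar>speed s\<bar> \<le> real m"
    unfolding 1 using bump_nonneg bump_le_1 by (auto simp: abs_mult mult_left_le)
  have "s * \<bar>speed' s\<bar> \<le> B * real m"
    using 2
  proof
    assume "\<rho> m / 4 < s \<and> s < \<rho> m"
    then have "s / \<rho> m \<le> 1" using \<rho>_pos[of m] by simp
    have "s * \<bar>speed' s\<bar> = real m * ((s / \<rho> m) * \<bar>bump' (s / \<rho> m)\<bar>)"
      unfolding 1 using \<rho>_pos[of m] by (simp add: abs_mult less_imp_neq[symmetric])
    also have "\<dots> \<le> real m * (1 * B)"
      using \<open>s / \<rho> m \<le> 1\<close> B s \<rho>_pos[of m] by (intro mult_left_mono mult_mono) auto
    finally show ?thesis by (simp add: mult.commute)
  qed (use \<open>B \<ge> 0\<close> in auto)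
  with le have "\<bar>speed s\<bar> + 2 * s * \<bar>speed' s\<bar> \<le> (1 + 2 * B) * real m"
    by (simp add: algebra_simps)
  with le 2 that show ?thesis by blast
qed

end

section \<open>The vortex and its Jacobian\<close>

lemma orthonormal_axis: "p \<noteq> q \<Longrightarrow> orthonormal (axis p 1 :: real^'n) (axis q 1)"
  by (auto simp: orthonormal_def inner_axis_axis)

text \<open>
  The condition \<open>\<rho>_square\<close> keeps the velocity bounded although the angular speed is not: in shell \<open>n\<close> the velocity is
  at most \<open>n \<bar>x\<bar> \<le> n sqrt (\<rho> n)\<close>.
\<close>

locale vortex = shells \<rho> for \<rho> :: "nat \<Rightarrow> real" +
  fixes p q :: "'n::finite" and B :: real
  assumes pq: "p \<noteq> q"
    and \<rho>_0: "\<rho> 0 \<le> 1/16"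
    and \<rho>_square: "(real n)\<^sup>2 * \<rho> n \<le> 1"
    and B: "\<bar>bump' z\<bar> \<le> B"
begin

definition turn :: "real^'n \<Rightarrow> real^'n" where
  "turn = quarter_turn (axis p 1) (axis q 1)"

definition b :: "real^'n \<Rightarrow> real^'n" where
  "b x = speed (x \<bullet> x) *\<^sub>R turn x"

text \<open>
  The rows of the matrix of \<open>turn\<close>.
\<close>

definition row :: "'n \<Rightarrow> real^'n" where
  "row i = (axis q 1 $ i) *\<^sub>R axis p 1 - (axis p 1 $ i) *\<^sub>R axis q 1"

definition Db :: "real^'n \<Rightarrow> real^'n^'n" where
  "Db x = (\<chi> i j. speed (x \<bullet> x) * row i $ j + 2 * speed' (x \<bullet> x) * x $ j * (x \<bullet> row i))"

text \<open>
  In shell \<open>m\<close> every entry of \<open>Db\<close> is at most \<open>(1 + 2 * B) * m\<close>, and the Frobenius norm is at most the sum of the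
  absolute values of the entries.
\<close>

definition C :: real where
  "C = (1 + 2 * B) * (real CARD('n))\<^sup>2"

lemma orthonormal_pq: "orthonormal (axis p 1 :: real^'n) (axis q 1)"
  using pq by (rule orthonormal_axis)

lemma B_nonneg: "B \<ge> 0" using B[of 0] by linarith

lemma C_nonneg: "C \<ge> 0" using B_nonneg by (simp add: C_def)

lemma turn_nth: "turn x $ i = x \<bullet> row i"
  by (simp add: turn_def quarter_turn_def row_def inner_diff_right inner_axis)

lemma b_nth: "b x $ i = speed (x \<bullet> x) * (x \<bullet> row i)"
  by (simp add: b_def turn_nth)

lemma borel_measurable_b [measurable]: "b \<in> borel_measurable borel"
  unfolding b_def[abs_def] turn_def quarter_turn_def by measurable

lemma row_cases: "row i = (if i = q then axis p 1 else if i = p then - axis q 1 else 0)"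
  using pq by (auto simp: row_def axis_def)

lemma norm_row: "norm (row i) \<le> 1"
  by (simp add: row_cases)

lemma norm_turn: "norm (turn x) \<le> norm x"
proof -
  note o = orthonormal_simps[OF orthonormal_pq]
  have [simp]: "(axis p 1 :: real^'n) $ q = 0" "(axis q 1 :: real^'n) $ p = 0"
    using pq by (simp_all add: axis_def)
  have "(norm (turn x))\<^sup>2 = (x $ p)\<^sup>2 + (x $ q)\<^sup>2"
    unfolding power2_norm_eq_inner
    by (simp add: turn_def quarter_turn_def o inner_diff_left inner_diff_right inner_axis power2_eq_square)
  also have "\<dots> = (\<Sum>i\<in>{p, q}. (x $ i)\<^sup>2)" using pq by simp
  also have "\<dots> \<le> (\<Sum>i\<in>UNIV. (x $ i)\<^sup>2)"
    by (rule sum_mono2) auto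
  also have "\<dots> = (norm x)\<^sup>2"
    unfolding power2_norm_eq_inner by (simp add: inner_vec_def power2_eq_square)
  finally show ?thesis by (rule power2_le_imp_le) simp
qed

lemma norm_b: "norm (b x) \<le> 1"
proof (rule speed_bound[OF B, of "x \<bullet> x"])
  fix m
  assume m: "\<bar>speed (x \<bullet> x)\<bar> \<le> real m"
    and "speed (x \<bullet> x) = 0 \<and> speed' (x \<bullet> x) = 0 \<or> x \<bullet> x < \<rho> m"
  then consider "speed (x \<bullet> x) = 0" | "x \<bullet> x < \<rho> m" by blast
  then show ?thesis
  proof cases
    case 2
    have "norm (b x) \<le> real m * norm x"
      unfolding b_def using m norm_turn[of x] by (simp add: mult_mono)
    moreover have "(real m * norm x)\<^sup>2 \<le> 1"
    proof -
      have "(real m * norm x)\<^sup>2 = (real m)\<^sup>2 * (x \<bullet> x)"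
        by (simp add: power_mult_distrib power2_norm_eq_inner)
      also have "\<dots> \<le> (real m)\<^sup>2 * \<rho> m" using 2 by (intro mult_left_mono) auto
      finally show ?thesis using \<rho>_square[of m] by linarith
    qed
    then have "real m * norm x \<le> 1" by (simp add: power_le_one_iff abs_square_le_1)
    ultimately show ?thesis by linarith
  qed (simp add: b_def)
qed simp

lemma b_outside: "x \<bullet> x \<ge> 1/16 \<Longrightarrow> b x = 0"
  using speed_outside[of "x \<bullet> x"] \<rho>_0 by (simp add: b_def)

lemma borel_measurable_Db [measurable]: "Db \<in> borel_measurable borel"
proof -
  have "(\<lambda>x. Db x \<bullet> axis i (axis j 1)) \<in> borel_measurable borel" for i j
    by (simp add: Db_def inner_axis) measurable
  then show ?thesis
    by (subst borel_measurable_euclidean_space) (auto simp: Basis_vec_def)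
qed

lemma norm_Db:
  obtains m where "norm (Db x) \<le> C * real m" "Db x = 0 \<or> x \<bullet> x < \<rho> m"
proof (rule speed_bound[OF B, of "x \<bullet> x"])
  fix m
  let ?s = "speed (x \<bullet> x)" and ?s' = "speed' (x \<bullet> x)"
  assume m: "\<bar>?s\<bar> + 2 * (x \<bullet> x) * \<bar>?s'\<bar> \<le> (1 + 2 * B) * real m"
    and 2: "?s = 0 \<and> ?s' = 0 \<or> x \<bullet> x < \<rho> m"
  have entry: "\<bar>Db x $ i $ j\<bar> \<le> (1 + 2 * B) * real m" for i j
  proof -
    have "\<bar>row i $ j\<bar> \<le> 1" using norm_row[of i] component_le_norm_cart[of "row i" j] by linarith
    moreover have "\<bar>x $ j\<bar> * \<bar>x \<bullet> row i\<bar> \<le> norm x * (norm x * 1)"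
    proof (intro mult_mono component_le_norm_cart)
      show "\<bar>x \<bullet> row i\<bar> \<le> norm x * 1"
        using Cauchy_Schwarz_ineq2[of x "row i"] mult_left_mono[OF norm_row[of i] norm_ge_zero[of x]]
        by linarith
    qed auto
    ultimately have "\<bar>?s\<bar> * \<bar>row i $ j\<bar> + 2 * \<bar>?s'\<bar> * (\<bar>x $ j\<bar> * \<bar>x \<bullet> row i\<bar>) \<le> \<bar>?s\<bar> * 1 + 2 * \<bar>?s'\<bar> * (x \<bullet> x)"
      by (intro add_mono mult_left_mono) (auto simp: power2_norm_eq_inner[symmetric] power2_eq_square)
    moreover have "\<bar>Db x $ i $ j\<bar> \<le> \<bar>?s\<bar> * \<bar>row i $ j\<bar> + 2 * \<bar>?s'\<bar> * (\<bar>x $ j\<bar> * \<bar>x \<bullet> row i\<bar>)"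
    proof -
      have "Db x $ i $ j = ?s * row i $ j + 2 * ?s' * (x $ j * (x \<bullet> row i))"
        by (simp add: Db_def)
      then show ?thesis
        using abs_triangle_ineq[of "?s * row i $ j" "2 * ?s' * (x $ j * (x \<bullet> row i))"]
        by (simp only: abs_mult) simp
    qed
    ultimately show ?thesis using m by (simp add: mult.commute mult.left_commute)
  qed
  have "norm (Db x) \<le> (\<Sum>i\<in>UNIV. norm (Db x $ i))"
    by (simp add: norm_vec_def L2_set_le_sum)
  also have "\<dots> \<le> (\<Sum>i\<in>UNIV. \<Sum>j\<in>UNIV. \<bar>Db x $ i $ j\<bar>)"
    by (intro sum_mono norm_le_l1_cart)
  also have "\<dots> \<le> (\<Sum>i\<in>(UNIV::'n set). \<Sum>j\<in>(UNIV::'n set). (1 + 2 * B) * real m)"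
    by (intro sum_mono entry)
  also have "\<dots> = C * real m" by (simp add: C_def power2_eq_square)
  finally have "norm (Db x) \<le> C * real m" .
  moreover have "Db x = 0 \<or> x \<bullet> x < \<rho> m"
    using 2 by (auto simp: Db_def vec_eq_iff)
  ultimately show ?thesis using that by blast
qed simp

end

section \<open>Weak derivatives of the vortex\<close>

lemma ess_supp_subset:
  assumes "closed K" "\<And>x. x \<notin> K \<Longrightarrow> f x = 0"
  shows "ess_supp f \<subseteq> K"
  using assms unfolding ess_supp_def by (auto intro!: exI[of _ "- K"])

lemma bounded_measurable_locally_integrable:
  fixes f :: "'a::euclidean_space \<Rightarrow> 'b::{banach, second_countable_topology}"
  assumes [measurable]: "f \<in> borel_measurable borel" and bd: "\<And>x. norm (f x) \<le> M"
  shows "locally_integrable S f"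
  unfolding locally_integrable_def set_integrable_def
proof safe
  fix K :: "'a set" assume "compact K"
  then have [measurable]: "K \<in> sets borel" and fin: "emeasure lborel K < \<infinity>"
    using borel_compact emeasure_compact_finite[OF \<open>compact K\<close>] by auto
  show "integrable lborel (\<lambda>x. indicator K x *\<^sub>R f x)"
  proof (rule Bochner_Integration.integrable_bound)
    show "integrable lborel (\<lambda>x. M * indicat_real K x)"
      using fin by (intro integrable_mult_right) (auto intro!: integrable_real_indicator)
    have "0 \<le> M" using bd norm_ge_zero order_trans by blast
    then show "AE x in lborel. norm (indicator K x *\<^sub>R f x) \<le> norm (M * indicat_real K x)"
      using bd by (auto simp: indicator_def)
  qed simp
qed

lemma integrable_locally_integrable:
  "integrable lborel f \<Longrightarrow> locally_integrable S f"
  unfolding locally_integrable_def set_integrable_def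
  by (auto intro!: integrable_mult_indicator borel_compact)

text \<open>
  In dimension \<open>d \<ge> 2\<close> a ball of radius \<open>sqrt r\<close> with \<open>r \<le> 1\<close> has volume of order \<open>r ^ (d / 2) \<le> r\<close>, so that the
  series is dominated by a geometric one.
\<close>

lemma nn_integral_sum_of_balls_finite:
  fixes h :: "nat \<Rightarrow> real" and \<rho> :: "nat \<Rightarrow> real"
  assumes d: "DIM('a::euclidean_space) \<ge> 2"
    and \<rho>: "\<And>n. 0 < \<rho> n" "\<And>n. \<rho> n \<le> 1" and h: "\<And>n. 0 \<le> h n" "\<And>n. h n * \<rho> n \<le> (1/2) ^ n"
  shows "(\<integral>\<^sup>+x. (\<Sum>n. ennreal (h n) * indicator (ball (0::'a) (sqrt (\<rho> n))) x) \<partial>lborel) < \<infinity>"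
proof -
  define \<kappa> where "\<kappa> = unit_ball_vol (real DIM('a))"
  have "\<kappa> \<ge> 0" by (simp add: \<kappa>_def)
  have [measurable, simp]: "ball (0::'a) r \<in> sets borel" for r by (rule borel_open) simp
  have ball: "ennreal (h n) * emeasure lborel (ball (0::'a) (sqrt (\<rho> n))) \<le> ennreal (\<kappa> * (1/2) ^ n)" for n
  proof -
    have "sqrt (\<rho> n) ^ DIM('a) \<le> sqrt (\<rho> n) ^ 2"
      using d \<rho>[of n] by (intro power_decreasing) auto
    then have "h n * (\<kappa> * sqrt (\<rho> n) ^ DIM('a)) \<le> h n * (\<kappa> * \<rho> n)"
      using \<rho>(1)[of n] h(1)[of n] \<open>\<kappa> \<ge> 0\<close> by (intro mult_left_mono) auto
    also have "\<dots> \<le> \<kappa> * (1/2) ^ n"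
      using mult_left_mono[OF h(2)[of n] \<open>\<kappa> \<ge> 0\<close>] by (simp add: ac_simps)
    finally show ?thesis
      using h(1)[of n] \<open>\<kappa> \<ge> 0\<close> \<rho>(1)[of n]
      by (simp add: emeasure_ball \<kappa>_def[symmetric] flip: ennreal_mult)
  qed
  have "(\<integral>\<^sup>+x. (\<Sum>n. ennreal (h n) * indicator (ball (0::'a) (sqrt (\<rho> n))) x) \<partial>lborel)
      = (\<Sum>n. ennreal (h n) * emeasure lborel (ball (0::'a) (sqrt (\<rho> n))))"
    by (subst nn_integral_suminf) (measurable, simp add: nn_integral_cmult_indicator)
  also have "\<dots> \<le> (\<Sum>n. ennreal (\<kappa> * (1/2) ^ n))"
    by (rule suminf_le[OF ball]) auto
  also have "\<dots> = ennreal (\<Sum>n. \<kappa> * (1/2) ^ n)"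
    using \<open>\<kappa> \<ge> 0\<close> by (intro suminf_ennreal2) (auto intro!: summable_mult summable_geometric)
  finally show ?thesis using order_le_less_trans by force
qed

context vortex
begin

lemma b_locally_integrable: "locally_integrable S b"
  by (rule bounded_measurable_locally_integrable[OF borel_measurable_b norm_b])

lemma \<rho>_le_1: "\<rho> n \<le> 1"
  using \<rho>_antimono[of 0 n] \<rho>_0 by simp

text \<open>
  In shell \<open>m\<close> the Jacobian is at most \<open>C * m\<close>, the shell lies in the ball of radius \<open>sqrt (\<rho> m)\<close>, and outside the shells
  the integrand vanishes because \<open>h 0 = 0\<close>. It is used for \<open>h = \<Phi>\<close> and, to have an integrable Jacobian, for the identity.
\<close>

lemma nn_integral_Db_finite:
  assumes d: "CARD('n) \<ge> 2"
    and h: "mono_on {0..} h" "h 0 = 0" "\<And>n. h (C * real n) * \<rho> n \<le> (1/2) ^ n"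
  shows "(\<integral>\<^sup>+x. ennreal (h (norm (Db x))) \<partial>lborel) < \<infinity>"
proof -
  have h_nonneg: "h (C * real n) \<ge> 0" for n
    using mono_onD[OF h(1), of 0 "C * real n"] C_nonneg h(2) by simp
  have "ennreal (h (norm (Db x))) \<le> (\<Sum>n. ennreal (h (C * real n)) * indicator (ball 0 (sqrt (\<rho> n))) x)" for x
  proof (rule norm_Db[of x])
    fix m
    assume m: "norm (Db x) \<le> C * real m" and "Db x = 0 \<or> x \<bullet> x < \<rho> m"
    then consider "Db x = 0" | "x \<bullet> x < \<rho> m" by blast
    then show ?thesis
    proof cases
      case 2
      then have "x \<in> ball 0 (sqrt (\<rho> m))"
        by (simp add: norm_eq_sqrt_inner)
      then have "ennreal (h (norm (Db x))) \<le> ennreal (h (C * real m)) * indicator (ball 0 (sqrt (\<rho> m))) x"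
        using mono_onD[OF h(1), of "norm (Db x)" "C * real m"] m norm_ge_zero[of "Db x"]
        by (auto intro!: ennreal_leI)
      also have "\<dots> \<le> (\<Sum>n. ennreal (h (C * real n)) * indicator (ball 0 (sqrt (\<rho> n))) x)"
      proof -
        have "F m \<le> suminf F" for F :: "nat \<Rightarrow> ennreal"
          using sum_le_suminf[of F "{m}"] by simp
        then show ?thesis .
      qed
      finally show ?thesis .
    qed (simp add: h(2))
  qed
  then have "(\<integral>\<^sup>+x. ennreal (h (norm (Db x))) \<partial>lborel)
      \<le> (\<integral>\<^sup>+x. (\<Sum>n. ennreal (h (C * real n)) * indicator (ball (0::real^'n) (sqrt (\<rho> n))) x) \<partial>lborel)"
    by (rule nn_integral_mono)
  also have "\<dots> < \<infinity>"
    using d \<rho>_pos \<rho>_le_1 h_nonneg h(3) by (intro nn_integral_sum_of_balls_finite) auto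
  finally show ?thesis .
qed

definition cut_component :: "nat \<Rightarrow> 'n \<Rightarrow> real^'n \<Rightarrow> real" where
  "cut_component N i x = cut_speed N (x \<bullet> x) * (x \<bullet> row i)"

lemma smooth_cut_component: "smooth (cut_component N i)"
  unfolding cut_component_def[abs_def]
  by (intro smooth_mult smooth_inner smooth_compose[OF smooth_cut_speed] smooth_inner_self)

lemma cut_component_pderiv:
  "pderiv_dir (cut_component N i) (axis j 1) x
     = cut_speed N (x \<bullet> x) * row i $ j + 2 * cut_speed' N (x \<bullet> x) * x $ j * (x \<bullet> row i)"
proof -
  have sq: "((\<lambda>x. x \<bullet> x) has_derivative (\<lambda>e. x \<bullet> e + e \<bullet> x)) (at x)"
    by (auto intro!: derivative_eq_intros)
  have "(cut_speed N has_derivative (\<lambda>h. cut_speed' N (x \<bullet> x) * h)) (at (x \<bullet> x))"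
    using cut_speed_has_derivative by (simp add: has_field_derivative_def)
  from has_derivative_compose[OF sq this]
  have 1: "((\<lambda>x. cut_speed N (x \<bullet> x)) has_derivative (\<lambda>e. cut_speed' N (x \<bullet> x) * (x \<bullet> e + e \<bullet> x))) (at x)" .
  have "((\<lambda>x. x \<bullet> row i) has_derivative (\<lambda>e. e \<bullet> row i)) (at x)"
    by (auto intro!: derivative_eq_intros)
  from pderiv_dir_eq[OF has_derivative_mult[OF 1 this]]
  show ?thesis
    by (simp add: cut_component_def[abs_def] inner_axis inner_axis')
qed

text \<open>
  The truncated fields are smooth, so they may be integrated by parts; both sides converge by dominated convergence,
  since a truncated field and its derivative agree with the full ones or vanish.
\<close>

lemma weak_jacobian_b:
  assumes "integrable lborel Db"
  shows "weak_jacobian b Db"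
  unfolding weak_jacobian_def weak_gradient_def
proof (intro allI conjI impI)
  fix i :: 'n
  have b_i: "locally_integrable UNIV (\<lambda>x. b x $ i)"
  proof (rule bounded_measurable_locally_integrable)
    show "(\<lambda>x. b x $ i) \<in> borel_measurable borel" by (simp add: b_nth)
    show "norm (b x $ i) \<le> 1" for x
      using order_trans[OF component_le_norm_cart norm_b] by simp
  qed
  then show "locally_integrable UNIV (\<lambda>x. b x $ i)" .
  have Db_i: "integrable lborel (\<lambda>x. Db x $ i)"
    using integrable_bounded_linear[OF bounded_linear_vec_nth assms] .
  then show loc: "locally_integrable UNIV (\<lambda>x. Db x $ i)"
    by (rule integrable_locally_integrable)
  fix \<phi> :: "real^'n \<Rightarrow> real" and j :: 'n
  assume test: "test_function \<phi>"
  have sm: "smooth \<phi>" and cont: "continuous_on UNIV \<phi>" and bd: "bounded {x. \<phi> x \<noteq> 0}"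
    using test test_function_smooth test_function_bounded smooth_continuous by blast+
  have cont': "continuous_on UNIV (pderiv_dir \<phi> (axis j 1))"
    using sm by (intro smooth_continuous smooth_pderiv_dir) simp_all
  note [measurable] = borel_measurable_continuous_onI[OF cont] borel_measurable_continuous_onI[OF cont']
  have [measurable]: "cut_component N i \<in> borel_measurable borel"
      "pderiv_dir (cut_component N i) (axis j 1) \<in> borel_measurable borel" for N
    using smooth_cut_component smooth_pderiv_dir[OF smooth_cut_component, of "axis j 1"]
    by (auto intro!: borel_measurable_continuous_onI smooth_continuous)
  have [measurable]: "(\<lambda>x. b x $ i) \<in> borel_measurable borel"
    by (simp add: b_nth)
  have Db_ij: "Db x $ i $ j = speed (x \<bullet> x) * row i $ j + 2 * speed' (x \<bullet> x) * x $ j * (x \<bullet> row i)" for x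
    by (simp add: Db_def)
  have [measurable]: "(\<lambda>x. Db x $ i $ j) \<in> borel_measurable borel"
    using Db_i integrable_bounded_linear[OF bounded_linear_vec_nth] borel_measurable_integrable by fastforce
  have cases: "cut_component N i x = b x $ i \<and> pderiv_dir (cut_component N i) (axis j 1) x = Db x $ i $ j
      \<or> cut_component N i x = 0 \<and> pderiv_dir (cut_component N i) (axis j 1) x = 0" for N x
    using cut_speed_eq_speed_or_0[of N "x \<bullet> x"]
    by (auto simp: cut_component_pderiv Db_ij b_nth cut_component_def)
  have ev: "\<forall>\<^sub>F N in sequentially. cut_component N i x = b x $ i
      \<and> pderiv_dir (cut_component N i) (axis j 1) x = Db x $ i $ j" for x
    using eventually_cut_speed[of "x \<bullet> x"]
    by eventually_elim (auto simp: cut_component_pderiv Db_ij b_nth cut_component_def)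
  have lim: "(\<lambda>N. \<integral>x. cut_component N i x * pderiv_dir \<phi> (axis j 1) x \<partial>lborel)
      \<longlonglongrightarrow> (\<integral>x. b x $ i * pderiv_dir \<phi> (axis j 1) x \<partial>lborel)"
  proof (rule integral_dominated_convergence)
    show "integrable lborel (\<lambda>x. norm (b x $ i * pderiv_dir \<phi> (axis j 1) x))"
      by (intro integrable_norm locally_integrable_times_test[OF b_locally_integrable cont'] bounded_pderiv_dir bd)
    show "AE x in lborel. (\<lambda>N. cut_component N i x * pderiv_dir \<phi> (axis j 1) x) \<longlonglongrightarrow> b x $ i * pderiv_dir \<phi> (axis j 1) x"
    proof (rule AE_I2, rule tendsto_eventually)
      fix x
      show "\<forall>\<^sub>F N in sequentially. cut_component N i x * pderiv_dir \<phi> (axis j 1) x = b x $ i * pderiv_dir \<phi> (axis j 1) x"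
        using ev[of x] by eventually_elim simp
    qed
    show "AE x in lborel. norm (cut_component N i x * pderiv_dir \<phi> (axis j 1) x)
        \<le> norm (b x $ i * pderiv_dir \<phi> (axis j 1) x)" for N
    proof (rule AE_I2)
      fix x
      show "norm (cut_component N i x * pderiv_dir \<phi> (axis j 1) x)
        \<le> norm (b x $ i * pderiv_dir \<phi> (axis j 1) x)"
        using cases[of N x] by auto
    qed
  qed measurable
  have lim': "(\<lambda>N. \<integral>x. pderiv_dir (cut_component N i) (axis j 1) x * \<phi> x \<partial>lborel)
      \<longlonglongrightarrow> (\<integral>x. Db x $ i $ j * \<phi> x \<partial>lborel)"
  proof (rule integral_dominated_convergence)
    show "integrable lborel (\<lambda>x. norm (Db x $ i $ j * \<phi> x))"
      by (intro integrable_norm locally_integrable_times_test[OF loc cont bd])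
    show "AE x in lborel. (\<lambda>N. pderiv_dir (cut_component N i) (axis j 1) x * \<phi> x) \<longlonglongrightarrow> Db x $ i $ j * \<phi> x"
    proof (rule AE_I2, rule tendsto_eventually)
      fix x
      show "\<forall>\<^sub>F N in sequentially. pderiv_dir (cut_component N i) (axis j 1) x * \<phi> x = Db x $ i $ j * \<phi> x"
        using ev[of x] by eventually_elim simp
    qed
    show "AE x in lborel. norm (pderiv_dir (cut_component N i) (axis j 1) x * \<phi> x)
        \<le> norm (Db x $ i $ j * \<phi> x)" for N
    proof (rule AE_I2)
      fix x
      show "norm (pderiv_dir (cut_component N i) (axis j 1) x * \<phi> x) \<le> norm (Db x $ i $ j * \<phi> x)"
        using cases[of N x] by auto
    qed
  qed measurable
  have "(\<integral>x. cut_component N i x * pderiv_dir \<phi> (axis j 1) x \<partial>lborel)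
      = - (\<integral>x. pderiv_dir (cut_component N i) (axis j 1) x * \<phi> x \<partial>lborel)" for N
    using smooth_cut_component[unfolded smooth_def] by (intro integral_by_parts test) auto
  with tendsto_minus[OF lim'] have "(\<lambda>N. \<integral>x. cut_component N i x * pderiv_dir \<phi> (axis j 1) x \<partial>lborel)
      \<longlonglongrightarrow> - (\<integral>x. Db x $ i $ j * \<phi> x \<partial>lborel)" by simp
  from LIMSEQ_unique[OF lim this]
  show "(\<integral>x. b x $ i * pderiv_dir \<phi> (axis j 1) x \<partial>lborel) = - (\<integral>x. Db x $ i $ j * \<phi> x \<partial>lborel)"
    .
qed

text \<open>
  The trace of \<open>Db\<close> vanishes: the quarter turn has no diagonal entries, and the gradient of the angular speed is radial
  while the velocity is tangential.
\<close>

lemma divergence_free_b: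
  assumes "integrable lborel Db"
  shows "divergence_free b"
  unfolding divergence_free_def
proof (intro conjI allI impI)
  show "locally_integrable UNIV b" by (rule b_locally_integrable)
  fix \<phi> :: "real^'n \<Rightarrow> real" assume test: "test_function \<phi>"
  have sm: "smooth \<phi>" and cont: "continuous_on UNIV \<phi>" and bd: "bounded {x. \<phi> x \<noteq> 0}"
    using test test_function_smooth test_function_bounded smooth_continuous by blast+
  have wg: "weak_gradient (\<lambda>x. b x $ i) (\<lambda>x. Db x $ i)" for i
    using weak_jacobian_b[OF assms] by (simp add: weak_jacobian_def)
  have int: "integrable lborel (\<lambda>x. b x $ i * pderiv_dir \<phi> (axis i 1) x)" for i
    using sm by (intro locally_integrable_times_test[OF b_locally_integrable] bounded_pderiv_dir bd
        smooth_continuous smooth_pderiv_dir) simp_all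
  have int': "integrable lborel (\<lambda>x. Db x $ i $ i * \<phi> x)" for i
    using wg by (intro locally_integrable_times_test cont bd) (simp add: weak_gradient_def)
  have "(\<integral>x. (\<Sum>i\<in>UNIV. b x $ i * pderiv_dir \<phi> (axis i 1) x) \<partial>lborel)
      = (\<Sum>i\<in>UNIV. - (\<integral>x. Db x $ i $ i * \<phi> x \<partial>lborel))"
    using wg test by (simp add: int weak_gradient_def)
  also have "\<dots> = - (\<integral>x. (\<Sum>i\<in>UNIV. Db x $ i $ i) * \<phi> x \<partial>lborel)"
    by (simp add: sum_distrib_right int' sum_negf)
  also have "(\<lambda>x. (\<Sum>i\<in>UNIV. Db x $ i $ i) * \<phi> x) = (\<lambda>x. 0)"
  proof
    fix x
    have "(\<Sum>i\<in>UNIV. Db x $ i $ i)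
        = speed (x \<bullet> x) * (\<Sum>i\<in>UNIV. row i $ i) + 2 * speed' (x \<bullet> x) * (\<Sum>i\<in>UNIV. x $ i * turn x $ i)"
      by (simp add: Db_def turn_nth sum.distrib sum_distrib_left mult.assoc)
    also have "(\<Sum>i\<in>UNIV. row i $ i) = 0"
      by (intro sum.neutral) (auto simp: row_def axis_def)
    also have "(\<Sum>i\<in>UNIV. x $ i * turn x $ i) = x \<bullet> turn x"
      by (simp add: inner_vec_def)
    also have "\<dots> = 0" by (simp add: turn_def quarter_turn_def inner_diff_right)
    finally show "(\<Sum>i\<in>UNIV. Db x $ i $ i) * \<phi> x = 0" by simp
  qed
  finally show "(\<integral>x. (\<Sum>i\<in>UNIV. b x $ i * pderiv_dir \<phi> (axis i 1) x) \<partial>lborel) = 0" by simp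
qed

end

section \<open>The flow and the transported function\<close>

lemma integrable_bounded_support:
  fixes f :: "'a::euclidean_space \<Rightarrow> real"
  assumes [measurable]: "f \<in> borel_measurable borel"
    and M: "AE x in lborel. \<bar>f x\<bar> \<le> M" and bd: "bounded {x. f x \<noteq> 0}"
  shows "integrable lborel f"
proof -
  obtain R where R: "\<And>x. f x \<noteq> 0 \<Longrightarrow> norm x \<le> R"
    using bd by (auto simp: bounded_iff)
  show ?thesis
  proof (rule Bochner_Integration.integrable_bound)
    show "integrable lborel (\<lambda>x::'a. M * indicat_real (cball 0 R) x)"
      using emeasure_lborel_cball_finite[of "0::'a" R]
      by (intro integrable_mult_right) (auto intro!: integrable_real_indicator)
    show "AE x in lborel. norm (f x) \<le> norm (M * indicat_real (cball 0 R) x)"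
      using M by eventually_elim (use R in \<open>fastforce simp: indicator_def\<close>)
  qed simp
qed

lemma measurable_fst_borel [measurable]:
    "fst \<in> borel_measurable (borel :: ('a::euclidean_space \<times> 'b::euclidean_space) measure)"
  and measurable_snd_borel [measurable]:
    "snd \<in> borel_measurable (borel :: ('a::euclidean_space \<times> 'b::euclidean_space) measure)"
  by (intro borel_measurable_continuous_onI continuous_intros)+

lemma pderiv_dir_linear_combination:
  fixes \<phi> :: "real \<times> (real^'n) \<Rightarrow> real"
  assumes "smooth \<phi>"
  shows "pderiv_dir \<phi> (s, v) z = s * pderiv_dir \<phi> (1, 0) z + (\<Sum>i\<in>UNIV. v $ i * pderiv_dir \<phi> (0, axis i 1) z)"
proof -
  have lin: "linear (\<lambda>e. pderiv_dir \<phi> e z)"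
    using smooth_has_derivative[OF assms] by (rule has_derivative_linear)
  have "(s, v) = s *\<^sub>R (1, 0) + (\<Sum>i\<in>UNIV. v $ i *\<^sub>R (0, axis i 1))"
    by (simp add: prod_eq_iff fst_sum snd_sum basis_expansion scalar_mult_eq_scaleR[symmetric])
  then have "pderiv_dir \<phi> (s, v) z
      = pderiv_dir \<phi> (s *\<^sub>R (1, 0) + (\<Sum>i\<in>UNIV. v $ i *\<^sub>R (0, axis i 1))) z"
    by (rule arg_cong)
  then show ?thesis
    by (simp only: linear_add[OF lin] linear_scale[OF lin] linear_sum[OF lin] real_scaleR_def)
qed

lemma (in shells) \<rho>_tendsto_0: "\<rho> \<longlonglongrightarrow> 0"
proof -
  have "\<rho> n \<le> \<rho> 0 * (1/4) ^ n" for n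
    by (induction n) (use \<rho>_quarter in \<open>auto intro: order_trans\<close>)
  moreover have "(\<lambda>n. \<rho> 0 * (1/4) ^ n) \<longlonglongrightarrow> 0"
    by (intro tendsto_mult_right_zero LIMSEQ_realpow_zero) auto
  ultimately show ?thesis
    using \<rho>_pos
    by (intro Lim_null_comparison[of \<rho> "\<lambda>n. \<rho> 0 * (1/4) ^ n"]) (simp_all add: less_imp_le)
qed

context vortex
begin

definition flow :: "real \<Rightarrow> real^'n \<Rightarrow> real^'n" where
  "flow t x = rot (axis p 1) (axis q 1) (t * speed (x \<bullet> x)) x"

definition space_time_flow :: "real \<times> (real^'n) \<Rightarrow> real \<times> (real^'n)" where
  "space_time_flow z = (fst z, flow (fst z) (snd z))"

lemma flow_inner_self: "flow t x \<bullet> flow t x = x \<bullet> x"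
  by (simp add: flow_def rot_inner_self[OF orthonormal_pq])

lemma flow_0: "flow 0 x = x"
  by (simp add: flow_def rot_0)

lemma flow_flow: "flow s (flow t x) = flow (s + t) x"
  by (simp add: flow_def[of _ "flow t x"] flow_inner_self)
    (simp add: flow_def rot_rot[OF orthonormal_pq] distrib_right)

lemma continuous_flow: "continuous_on S (\<lambda>t. flow t x)"
  unfolding flow_def rot_def by (intro continuous_intros)

lemma space_time_flow_eq_rot:
  "space_time_flow z = rot (0, axis p 1) (0, axis q 1) (fst z * speed (snd z \<bullet> snd z)) z"
  by (simp add: space_time_flow_def flow_def rot_def prod_eq_iff inner_Pair inner_prod_def)

text \<open>
  In space-time the flow is a rotation whose angle depends only on the time and on the distance to the origin, both
  invariant under the rotations.
\<close>

lemma preserves_lborel_space_time_flow: "preserves_lborel space_time_flow"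
proof -
  define \<tau> :: "real \<times> (real^'n) \<Rightarrow> real" where "\<tau> z = fst z * speed (snd z \<bullet> snd z)" for z
  define P Q :: "real \<times> (real^'n)" where "P = (0, axis p 1)" and "Q = (0, axis q 1)"
  have on: "orthonormal P Q"
    using orthonormal_pq by (simp add: orthonormal_def P_def Q_def)
  have [measurable]: "\<tau> \<in> borel_measurable borel" unfolding \<tau>_def[abs_def] by measurable
  have "\<tau> (rot P Q c z) = \<tau> z" for c z
  proof -
    have "fst (rot P Q c z) = fst z" "snd (rot P Q c z) = rot (axis p 1) (axis q 1) c (snd z)"
      by (simp_all add: rot_def P_def Q_def inner_prod_def)
    then show ?thesis by (simp add: \<tau>_def rot_inner_self[OF orthonormal_pq])
  qed
  then have "preserves_lborel (\<lambda>z. rot P Q (\<tau> z) z)"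
    by (intro preserves_lborel_twist on) auto
  also have "(\<lambda>z. rot P Q (\<tau> z) z) = space_time_flow"
    by (simp add: space_time_flow_eq_rot \<tau>_def P_def Q_def fun_eq_iff)
  finally show ?thesis .
qed

lemma borel_measurable_space_time_flow [measurable]: "space_time_flow \<in> borel_measurable borel"
  by (rule preserves_lborel_measurable[OF preserves_lborel_space_time_flow])

definition material_derivative :: "(real \<times> (real^'n) \<Rightarrow> real) \<Rightarrow> real \<times> (real^'n) \<Rightarrow> real" where
  "material_derivative \<phi> z
     = pderiv_dir \<phi> (1, 0) z + (\<Sum>i\<in>UNIV. b (snd z) $ i * pderiv_dir \<phi> (0, axis i 1) z)"

text \<open>
  The trajectory through \<open>y\<close> is explicit because \<open>y \<bullet> y\<close>, and with it the angular speed, is constant along it.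
\<close>

lemma material_derivative_along_flow:
  assumes "smooth \<phi>"
  shows "((\<lambda>t. \<phi> (t, flow t y)) has_real_derivative material_derivative \<phi> (t, flow t y)) (at t)"
proof -
  have "((\<lambda>t. flow t y) has_vector_derivative b (flow t y)) (at t)"
    using rot_has_vector_derivative[OF orthonormal_pq, of "speed (y \<bullet> y)" y t UNIV]
    by (simp add: b_def turn_def flow_def[of _ y] rot_inner_self[OF orthonormal_pq])
  then have "((\<lambda>t. (t, flow t y)) has_vector_derivative (1, b (flow t y))) (at t)"
    by (intro has_vector_derivative_Pair) (auto intro!: derivative_eq_intros)
  from vector_derivative_diff_chain_within[OF this has_derivative_at_withinI[OF smooth_has_derivative[OF assms]]]
  show ?thesis
    unfolding has_real_derivative_iff_has_vector_derivative comp_def material_derivative_def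
    by (subst (asm) pderiv_dir_linear_combination[OF assms]) simp
qed

lemma material_derivative_props:
  assumes "test_function \<phi>"
  shows borel_measurable_material_derivative: "material_derivative \<phi> \<in> borel_measurable borel"
    and "\<exists>M. \<forall>z. \<bar>material_derivative \<phi> z\<bar> \<le> M"
    and bounded_support_material_derivative: "bounded {z. material_derivative \<phi> z \<noteq> 0}"
    and continuous_material_derivative_along_flow: "continuous_on UNIV (\<lambda>t. material_derivative \<phi> (t, flow t y))"
proof -
  have sm: "smooth \<phi>" and bd: "bounded {z. \<phi> z \<noteq> 0}"
    using assms test_function_smooth test_function_bounded by blast+
  have basis: "(1, 0) \<in> (Basis :: (real \<times> (real^'n)) set)" "(0, axis i 1) \<in> (Basis :: (real \<times> (real^'n)) set)" for i
    by (auto simp: Basis_prod_def)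
  have cont: "continuous_on UNIV (pderiv_dir \<phi> (1, 0))" "continuous_on UNIV (pderiv_dir \<phi> (0, axis i 1))" for i
    using smooth_continuous[OF smooth_pderiv_dir[OF sm basis(1)]] smooth_continuous[OF smooth_pderiv_dir[OF sm basis(2)]]
    by blast+
  note [measurable] = cont[THEN borel_measurable_continuous_onI]
  have [measurable]: "(\<lambda>x. b x $ i) \<in> borel_measurable borel" for i by (simp add: b_nth)
  show "material_derivative \<phi> \<in> borel_measurable borel"
    unfolding material_derivative_def[abs_def] by measurable
  show "continuous_on UNIV (\<lambda>t. material_derivative \<phi> (t, flow t y))"
    unfolding material_derivative_def b_nth flow_inner_self snd_conv
    by (intro continuous_intros continuous_flow continuous_on_compose2[OF cont(1)] continuous_on_compose2[OF cont(2)]) auto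
  show "bounded {z. material_derivative \<phi> z \<noteq> 0}"
  proof (rule bounded_subset)
    show "bounded (supp \<phi>)" using bd by (simp add: supp_def bounded_closure)
    show "{z. material_derivative \<phi> z \<noteq> 0} \<subseteq> supp \<phi>"
      by (rule subsetI, rule ccontr) (simp add: material_derivative_def pderiv_dir_outside_supp)
  qed
  obtain M0 where M0: "\<And>z. \<bar>pderiv_dir \<phi> (1, 0) z\<bar> \<le> M0"
    using continuous_bounded_support_bounded[OF cont(1) bounded_pderiv_dir[OF bd]] by blast
  have "\<forall>i. \<exists>M. \<forall>z. \<bar>pderiv_dir \<phi> (0, axis i 1) z\<bar> \<le> M"
    using continuous_bounded_support_bounded[OF cont(2) bounded_pderiv_dir[OF bd]] by metis
  then obtain M where M: "\<And>i z. \<bar>pderiv_dir \<phi> (0, axis i 1) z\<bar> \<le> M i" by metis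
  have "\<bar>material_derivative \<phi> z\<bar> \<le> M0 + (\<Sum>i\<in>UNIV. 1 * M i)" for z
  proof -
    have "\<bar>b (snd z) $ i\<bar> \<le> 1" for i
      using order_trans[OF component_le_norm_cart norm_b] .
    then have "\<bar>b (snd z) $ i * pderiv_dir \<phi> (0, axis i 1) z\<bar> \<le> 1 * M i" for i
      unfolding abs_mult using M[of i z] by (intro mult_mono) auto
    then have "\<bar>\<Sum>i\<in>UNIV. b (snd z) $ i * pderiv_dir \<phi> (0, axis i 1) z\<bar> \<le> (\<Sum>i\<in>UNIV. 1 * M i)"
      by (intro order_trans[OF sum_abs] sum_mono)
    with M0[of z] show ?thesis unfolding material_derivative_def by linarith
  qed
  then show "\<exists>M. \<forall>z. \<bar>material_derivative \<phi> z\<bar> \<le> M" by blast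
qed

lemma integrable_times_material_derivative:
  assumes w[measurable]: "w \<in> borel_measurable borel" and M: "AE z in lborel. \<bar>w z\<bar> \<le> M"
    and test: "test_function \<phi>"
  shows "integrable lborel (\<lambda>z. w z * material_derivative \<phi> z)"
proof -
  note [measurable] = borel_measurable_material_derivative[OF test]
  obtain K where K: "\<And>z. \<bar>material_derivative \<phi> z\<bar> \<le> K"
    using material_derivative_props(2)[OF test] by blast
  show ?thesis
  proof (rule integrable_bounded_support)
    show "AE z in lborel. \<bar>w z * material_derivative \<phi> z\<bar> \<le> M * K"
      using M by eventually_elim (use K in \<open>auto simp: abs_mult intro!: mult_mono intro: order_trans[OF abs_ge_zero]\<close>)
    show "bounded {z. w z * material_derivative \<phi> z \<noteq> 0}"
      by (rule bounded_subset[OF bounded_support_material_derivative[OF test]]) auto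
  qed measurable
qed

lemma transport_solution_iff:
  "transport_solution (\<lambda>_. b) u0 u \<longleftrightarrow>
     L_infinity ({0..} \<times> UNIV) (\<lambda>(t, x). u t x) \<and>
     (\<forall>\<phi>. test_function \<phi> \<longrightarrow>
        (\<integral>z. (indicat_real {0..} (fst z) * u (fst z) (snd z)) * material_derivative \<phi> z \<partial>lborel)
        + (\<integral>x. u0 x * \<phi> (0, x) \<partial>lborel) = 0)"
proof -
  have "(LINT (t, x):{0..} \<times> UNIV|lborel.
            u t x * (pderiv_dir \<phi> (1, 0) (t, x)
                     + (\<Sum>i\<in>UNIV. b x $ i * pderiv_dir \<phi> (0, axis i 1) (t, x))))
      = (\<integral>z. (indicat_real {0..} (fst z) * u (fst z) (snd z)) * material_derivative \<phi> z \<partial>lborel)" for \<phi>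
    unfolding set_lebesgue_integral_def
    by (intro Bochner_Integration.integral_cong refl)
      (auto simp: material_derivative_def indicator_def)
  then show ?thesis unfolding transport_solution_def by simp
qed

definition transported :: "(real^'n \<Rightarrow> real) \<Rightarrow> real \<Rightarrow> real^'n \<Rightarrow> real" where
  "transported u0 t x = u0 (flow (- t) x)"

context
  fixes u0 :: "real^'n \<Rightarrow> real" and M0 :: real
  assumes u0_cont: "continuous_on UNIV u0" and u0_bound: "\<And>x. \<bar>u0 x\<bar> \<le> M0"
begin

lemma borel_measurable_u0 [measurable]: "u0 \<in> borel_measurable borel"
  using u0_cont by (rule borel_measurable_continuous_onI)

lemma borel_measurable_transported [measurable]:
  "(\<lambda>z. transported u0 (fst z) (snd z)) \<in> borel_measurable borel"
  unfolding transported_def flow_def rot_def by measurable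

lemma borel_measurable_transported_slice [measurable]: "transported u0 t \<in> borel_measurable borel"
  unfolding transported_def[abs_def] flow_def rot_def by measurable

lemma transported_bound: "\<bar>transported u0 t x\<bar> \<le> M0"
  by (simp add: transported_def u0_bound)

lemma weak_star_continuous_transported: "weak_star_continuous (transported u0)"
  unfolding weak_star_continuous_def
proof (intro conjI allI impI)
  show "L_infinity UNIV (transported u0 t)" for t
    unfolding L_infinity_def set_borel_measurable_def using transported_bound by auto
  fix g :: "real^'n \<Rightarrow> real" assume g: "integrable lborel g"
  then have [measurable]: "g \<in> borel_measurable borel" by auto
  show "continuous_on {0..} (\<lambda>t. \<integral>x. transported u0 t x * g x \<partial>lborel)"
  proof (rule continuous_on_sequentiallyI)
    fix s :: "nat \<Rightarrow> real" and t assume s: "s \<longlonglongrightarrow> t"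
    show "(\<lambda>n. \<integral>x. transported u0 (s n) x * g x \<partial>lborel) \<longlonglongrightarrow> (\<integral>x. transported u0 t x * g x \<partial>lborel)"
    proof (rule integral_dominated_convergence)
      show "integrable lborel (\<lambda>x. M0 * norm (g x))" using g by simp
      show "AE x in lborel. norm (transported u0 (s n) x * g x) \<le> M0 * norm (g x)" for n
        using transported_bound by (auto simp: abs_mult intro!: mult_right_mono)
      show "AE x in lborel. (\<lambda>n. transported u0 (s n) x * g x) \<longlonglongrightarrow> transported u0 t x * g x"
      proof (rule AE_I2)
        fix x
        have "(\<lambda>n. flow (- s n) x) \<longlonglongrightarrow> flow (- t) x"
          by (rule continuous_on_tendsto_compose[OF continuous_flow[of UNIV] tendsto_minus[OF s]]) auto
        from continuous_on_tendsto_compose[OF u0_cont this]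
        show "(\<lambda>n. transported u0 (s n) x * g x) \<longlonglongrightarrow> transported u0 t x * g x"
          unfolding transported_def by (intro tendsto_mult tendsto_const) auto
      qed
    qed measurable
  qed
qed

text \<open>
  In the coordinates that move with the flow the solution is constant in time and the transport operator becomes the
  time derivative of \<open>t \<mapsto> \<phi> (t, flow t y)\<close>, whose integral over \<open>t \<ge> 0\<close> is \<open>- \<phi> (0, y)\<close>.
\<close>

lemma transport_solution_transported:
  assumes u0_supp: "bounded {x. u0 x \<noteq> 0}"
  shows "transport_solution (\<lambda>_. b) u0 (transported u0)"
  unfolding transport_solution_iff
proof (intro conjI allI impI)
  have [measurable]: "{0::real..} \<times> (UNIV :: (real^'n) set) \<in> sets borel"
    by (intro borel_closed closed_Times) auto
  show "L_infinity ({0..} \<times> UNIV) (\<lambda>(t, x). transported u0 t x)"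
    unfolding L_infinity_def set_borel_measurable_def case_prod_beta using transported_bound by auto
  fix \<phi> :: "real \<times> (real^'n) \<Rightarrow> real" assume test: "test_function \<phi>"
  note sm = test_function_smooth[OF test]
  note [measurable] = borel_measurable_material_derivative[OF test]
  define w where "w = (\<lambda>z::real \<times> (real^'n). indicat_real {0..} (fst z) * transported u0 (fst z) (snd z))"
  have w[measurable]: "w \<in> borel_measurable borel" unfolding w_def by measurable
  have w_bound: "AE z in lborel. \<bar>w z\<bar> \<le> M0"
    using transported_bound order_trans[OF abs_ge_zero u0_bound] by (auto simp: w_def indicator_def)
  have int: "integrable lborel (\<lambda>z. w z * material_derivative \<phi> z)"
    by (rule integrable_times_material_derivative[OF w w_bound test])
  define h where "h = (\<lambda>z::real \<times> (real^'n). indicat_real {0..} (fst z) * u0 (snd z) * material_derivative \<phi> (space_time_flow z))"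
  have h_eq: "w (space_time_flow z) * material_derivative \<phi> (space_time_flow z) = h z" for z
    by (simp add: w_def h_def transported_def space_time_flow_def flow_flow flow_0)
  have int_h: "integrable lborel h"
    using integrable_preserves_lborel[OF preserves_lborel_space_time_flow, of "\<lambda>z. w z * material_derivative \<phi> z"] int
    by (simp add: h_eq)
  obtain T where T: "\<And>z. material_derivative \<phi> z \<noteq> 0 \<Longrightarrow> norm z \<le> T" "\<And>z. \<phi> z \<noteq> 0 \<Longrightarrow> norm z < T" "T > 0"
  proof -
    have "bounded ({z. material_derivative \<phi> z \<noteq> 0} \<union> {z. \<phi> z \<noteq> 0})"
      using bounded_support_material_derivative[OF test] test_function_bounded[OF test] by simp
    then obtain T where "T > 0" "\<forall>z \<in> {z. material_derivative \<phi> z \<noteq> 0} \<union> {z. \<phi> z \<noteq> 0}. norm z \<le> T"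
      by (meson bounded_pos)
    then show ?thesis by (intro that[of "T + 1"]) (auto intro: add_increasing2 le_less_trans)
  qed
  have inner: "(\<integral>t. h (t, y) \<partial>lborel) = - (u0 y * \<phi> (0, y))" for y
  proof -
    define F where "F = (\<lambda>t. \<phi> (t, flow t y))"
    have "(\<integral>t. h (t, y) \<partial>lborel) = (\<integral>t. u0 y * (material_derivative \<phi> (t, flow t y) * indicator {0..T} t) \<partial>lborel)"
    proof (intro Bochner_Integration.integral_cong refl)
      fix t
      have "\<bar>t\<bar> \<le> T" if "material_derivative \<phi> (t, flow t y) \<noteq> 0"
        using T(1)[OF that] norm_fst_le[of t "flow t y"] by simp
      then show "h (t, y) = u0 y * (material_derivative \<phi> (t, flow t y) * indicator {0..T} t)"
        by (auto simp: h_def space_time_flow_def indicator_def)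
    qed
    also have "\<dots> = u0 y * (F T - F 0)"
    proof -
      have "(\<integral>t. material_derivative \<phi> (t, flow t y) * indicator {0..T} t \<partial>lborel) = F T - F 0"
      proof (rule integral_FTC_Icc_real)
        show "(F has_real_derivative material_derivative \<phi> (t, flow t y)) (at t)" for t
          unfolding F_def by (rule material_derivative_along_flow[OF sm])
        show "isCont (\<lambda>t. material_derivative \<phi> (t, flow t y)) t" for t
          using continuous_material_derivative_along_flow[OF test, of y] by (simp add: continuous_on_eq_continuous_at)
      qed (use T in simp)
      then show ?thesis by simp
    qed
    also have "F T = 0"
      using T(2)[of "(T, flow T y)"] norm_fst_le[of T "flow T y"] T(3) by (fastforce simp: F_def)
    finally show ?thesis by (simp add: F_def flow_0)
  qed
  have "(\<integral>z. w z * material_derivative \<phi> z \<partial>lborel) = (\<integral>z. h z \<partial>lborel)"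
    using integral_preserves_lborel[OF preserves_lborel_space_time_flow, of "\<lambda>z. w z * material_derivative \<phi> z"]
    by (simp add: h_eq)
  also have "\<dots> = (\<integral>y. (\<integral>t. h (t, y) \<partial>lborel) \<partial>lborel)"
    using lborel_pair.integral_snd[of "\<lambda>t y. h (t, y)"] int_h by (simp add: lborel_prod)
  also have "\<dots> = - (\<integral>y. u0 y * \<phi> (0, y) \<partial>lborel)"
    unfolding inner by simp
  finally show "(\<integral>z. (indicat_real {0..} (fst z) * transported u0 (fst z) (snd z)) * material_derivative \<phi> z \<partial>lborel)
      + (\<integral>x. u0 x * \<phi> (0, x) \<partial>lborel) = 0"
    by (simp add: w_def)
qed

end

end

section \<open>Uniqueness of the bounded solution\<close>

text \<open>
  Then \<open>1 + W / M\<close> is the density of a measure that gives every box its volume, that is, of Lebesgue measure itself;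
  and densities are unique.
\<close>

lemma AE_eq_0_if_box_integrals_eq_0:
  fixes W :: "'a::euclidean_space \<Rightarrow> real"
  assumes W[measurable]: "W \<in> borel_measurable borel" and M: "AE x in lborel. \<bar>W x\<bar> \<le> M" and "M > 0"
    and zero: "\<And>l u. (\<integral>x. W x * indicator (box l u) x \<partial>lborel) = 0"
  shows "AE x in lborel. W x = 0"
proof -
  define g where "g = (\<lambda>x. 1 + W x / M)"
  have [measurable]: "g \<in> borel_measurable borel" unfolding g_def by measurable
  have g_nonneg: "AE x in lborel. 0 \<le> g x"
    using M by eventually_elim (use \<open>M > 0\<close> in \<open>auto simp: g_def field_simps\<close>)
  have "lborel = density lborel (\<lambda>x. ennreal (g x))"
  proof (rule lborel_eqI)
    fix l u :: 'a assume lu: "\<And>b. b \<in> Basis \<Longrightarrow> l \<bullet> b \<le> u \<bullet> b"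
    have int1: "integrable lborel (indicat_real (box l u))"
      using emeasure_lborel_box_finite[of l u] by (auto intro!: integrable_real_indicator)
    have intW: "integrable lborel (\<lambda>x. W x * indicat_real (box l u) x)"
    proof (rule integrable_bounded_support)
      show "AE x in lborel. \<bar>W x * indicat_real (box l u) x\<bar> \<le> M"
        using M by eventually_elim (use \<open>M > 0\<close> in \<open>auto simp: indicator_def\<close>)
      show "bounded {x. W x * indicat_real (box l u) x \<noteq> 0}"
        by (rule bounded_subset[OF bounded_box[of l u]]) (auto simp: indicator_def)
    qed measurable
    have g_eq: "(\<lambda>x. g x * indicat_real (box l u) x)
        = (\<lambda>x. indicat_real (box l u) x + (W x * indicat_real (box l u) x) / M)"
      by (auto simp: g_def algebra_simps)
    have intg: "integrable lborel (\<lambda>x. g x * indicat_real (box l u) x)"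
      unfolding g_eq using int1 intW by simp
    have "emeasure (density lborel (\<lambda>x. ennreal (g x))) (box l u)
        = (\<integral>\<^sup>+x. ennreal (g x) * indicator (box l u) x \<partial>lborel)"
      by (rule emeasure_density) auto
    also have "\<dots> = (\<integral>\<^sup>+x. ennreal (g x * indicat_real (box l u) x) \<partial>lborel)"
      by (intro nn_integral_cong) (auto simp: indicator_def)
    also have "\<dots> = ennreal (\<integral>x. g x * indicat_real (box l u) x \<partial>lborel)"
    proof (rule nn_integral_eq_integral[OF intg])
      show "AE x in lborel. 0 \<le> g x * indicat_real (box l u) x"
        using g_nonneg by eventually_elim auto
    qed
    also have "(\<integral>x. g x * indicat_real (box l u) x \<partial>lborel) = (\<integral>x. indicat_real (box l u) x \<partial>lborel)"
      unfolding g_eq using int1 intW zero by simp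
    also have "\<dots> = (\<Prod>b\<in>Basis. (u - l) \<bullet> b)"
      using lu by (simp add: measure_lborel_box_eq inner_diff_left)
    finally show "emeasure (density lborel (\<lambda>x. ennreal (g x))) (box l u) = (\<Prod>b\<in>Basis. (u - l) \<bullet> b)" .
  qed simp
  then have "density lborel (\<lambda>_. 1) = density lborel (\<lambda>x. ennreal (g x))"
    by (simp add: density_1)
  then have "AE x in lborel. 1 = ennreal (g x)"
    by (intro sigma_finite_measure.density_unique[OF sigma_finite_lborel]) auto
  then show ?thesis
    using g_nonneg by eventually_elim (use \<open>M > 0\<close> in \<open>auto simp: g_def ennreal_eq_1\<close>)
qed

lemma smooth_antiderivative:
  fixes \<beta> :: "real \<Rightarrow> real"
  assumes sm: "smooth \<beta>" and zero: "\<And>t. t \<le> 0 \<or> T \<le> t \<Longrightarrow> \<beta> t = 0"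
  obtains A c where "smooth A" "\<And>t. (A has_real_derivative \<beta> t) (at t)"
    "\<And>t. t \<le> 0 \<Longrightarrow> A t = 0" "\<And>t. t \<ge> T \<Longrightarrow> A t = c"
proof -
  \<comment> \<open>the lower limit lies to the left of \<open>0\<close> so that \<open>A\<close> is differentiable at \<open>0\<close> too\<close>
  define A where "A t = integral {-1..t} \<beta>" for t
  have A_0: "A t = 0" if "t \<le> 0" for t
  proof -
    have "integral {-1..t} \<beta> = integral {-1..t} (\<lambda>_. 0)"
      using that zero by (intro Henstock_Kurzweil_Integration.integral_cong) auto
    then show ?thesis by (simp add: A_def)
  qed
  have deriv: "(A has_real_derivative \<beta> t) (at t)" for t
  proof (cases "t < 0")
    case True
    have "((\<lambda>_. 0) has_real_derivative \<beta> t) (at t)" using True zero by simp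
    then show ?thesis
      by (rule has_field_derivative_transform_within_open[where S="{..<0}"]) (use True A_0 in auto)
  next
    case False
    have "(A has_real_derivative \<beta> t) (at t within {-1..t+1})"
      unfolding A_def[abs_def]
      using False smooth_continuous[OF sm] by (intro integral_has_real_derivative) (auto intro: continuous_on_subset)
    then show ?thesis
      using False by (simp add: at_within_Icc_at)
  qed
  have "\<exists>c. \<forall>t\<in>{T..}. A t = c"
  proof (rule has_field_derivative_zero_constant)
    fix t assume "t \<in> {T..}"
    then show "(A has_field_derivative 0) (at t within {T..})"
      using deriv[of t] zero[of t] by (auto intro: has_field_derivative_at_within)
  qed auto
  then obtain c where "\<And>t. t \<ge> T \<Longrightarrow> A t = c" by auto
  with that smooth_realI[OF deriv sm] deriv A_0 show ?thesis by blast
qed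

text \<open>
  An antiderivative \<open>A\<close> of \<open>\<beta>\<close> is constant after time \<open>T\<close>. Subtracting the same function moved to the left by \<open>T\<close>
  cancels this constant and does not change the derivative at positive times.
\<close>

lemma test_function_with_prescribed_derivative:
  fixes \<beta> :: "real \<Rightarrow> real"
  assumes sm: "smooth \<beta>" and zero: "\<And>t. t \<le> 0 \<or> T \<le> t \<Longrightarrow> \<beta> t = 0" and T: "T \<ge> 0"
  obtains \<alpha> where "test_function \<alpha>" "\<And>t. t \<ge> 0 \<Longrightarrow> (\<alpha> has_real_derivative \<beta> t) (at t)"
proof -
  obtain A c where A: "smooth A" "\<And>t. (A has_real_derivative \<beta> t) (at t)"
    "\<And>t. t \<le> 0 \<Longrightarrow> A t = 0" "\<And>t. t \<ge> T \<Longrightarrow> A t = c"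
    using smooth_antiderivative[OF sm zero] by blast
  define \<alpha> where "\<alpha> t = A t - A (t + T)" for t
  have "test_function \<alpha>"
  proof (rule test_functionI)
    show "smooth \<alpha>"
      unfolding \<alpha>_def[abs_def]
      by (intro smooth_diff A smooth_compose[OF A(1)] smooth_add smooth_ident smooth_const)
    have "\<alpha> t = 0" if "\<not> \<bar>t\<bar> \<le> T" for t
      using A(3,4)[of t] A(3,4)[of "t + T"] that T by (auto simp: \<alpha>_def abs_le_iff)
    then have "{t. \<alpha> t \<noteq> 0} \<subseteq> {-T..T}" by (force simp: abs_le_iff)
    then show "bounded {t. \<alpha> t \<noteq> 0}"
      by (rule bounded_subset[OF bounded_closed_interval])
  qed
  moreover have "(\<alpha> has_real_derivative \<beta> t) (at t)" if "t \<ge> 0" for t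
  proof -
    have "((\<lambda>t. A (t + T)) has_real_derivative 0) (at t)"
      using DERIV_shift[of A 0 t T] A(2)[of "t + T"] zero[of "t + T"] that by simp
    from DERIV_diff[OF A(2)[of t] this] show ?thesis by (simp add: \<alpha>_def[abs_def])
  qed
  ultimately show ?thesis using that by blast
qed

definition smooth_interval :: "nat \<Rightarrow> real \<Rightarrow> real \<Rightarrow> real \<Rightarrow> real" where
  "smooth_interval k a b t = smooth_step (real k * (t - a)) * smooth_step (real k * (b - t))"

lemma smooth_smooth_interval: "smooth f \<Longrightarrow> smooth (\<lambda>x. smooth_interval k a b (f x))"
  unfolding smooth_interval_def
  by (intro smooth_mult smooth_smooth_step_compose smooth_const smooth_diff)

lemma smooth_interval_outside: "t \<le> a \<or> b \<le> t \<Longrightarrow> smooth_interval k a b t = 0"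
  by (auto simp: smooth_interval_def smooth_step_zero mult_nonneg_nonpos)

lemma smooth_interval_nonneg: "0 \<le> smooth_interval k a b t"
  and smooth_interval_le_1: "smooth_interval k a b t \<le> 1"
  by (auto simp: smooth_interval_def smooth_step_nonneg smooth_step_le_1 intro!: mult_le_one)

lemma smooth_interval_tendsto: "(\<lambda>k. smooth_interval k a b t) \<longlonglongrightarrow> indicat_real {a<..<b} t"
proof -
  have "(\<lambda>k. smooth_interval k a b t) \<longlonglongrightarrow> indicat_real {0<..} (t - a) * indicat_real {0<..} (b - t)"
    unfolding smooth_interval_def
    using smooth_step_scaled_tendsto[of 0] by (intro tendsto_mult) auto
  also have "indicat_real {0<..} (t - a) * indicat_real {0<..} (b - t) = indicat_real {a<..<b} t"
    by (auto simp: indicator_def)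
  finally show ?thesis .
qed

text \<open>
  The first factor keeps the function away from the origin, where the flow is not smooth. It disappears in the
  limit \<open>k \<rightarrow> \<infinity>\<close> except at the origin itself.
\<close>

definition smooth_box :: "nat \<Rightarrow> 'a::euclidean_space \<Rightarrow> 'a \<Rightarrow> 'a \<Rightarrow> real" where
  "smooth_box k l u y = smooth_step (real k * (y \<bullet> y) - 1) * (\<Prod>i\<in>Basis. smooth_interval k (l \<bullet> i) (u \<bullet> i) (y \<bullet> i))"

lemma smooth_box_tendsto: "y \<noteq> 0 \<Longrightarrow> (\<lambda>k. smooth_box k l u y) \<longlonglongrightarrow> indicat_real (box l u) y"
proof -
  assume "y \<noteq> 0"
  have "(\<lambda>k. smooth_box k l u y) \<longlonglongrightarrow> indicat_real {0<..} (y \<bullet> y) * (\<Prod>i\<in>Basis. indicat_real {l \<bullet> i<..<u \<bullet> i} (y \<bullet> i))"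
    unfolding smooth_box_def
    by (intro tendsto_mult tendsto_prod smooth_interval_tendsto smooth_step_scaled_tendsto) auto
  also have "indicat_real {0<..} (y \<bullet> y) * (\<Prod>i\<in>Basis. indicat_real {l \<bullet> i<..<u \<bullet> i} (y \<bullet> i)) = indicat_real (box l u) y"
    using \<open>y \<noteq> 0\<close> by (auto simp: indicator_def mem_box)
  finally show ?thesis .
qed

lemma smooth_box_nonneg: "0 \<le> smooth_box k l u y"
  and smooth_box_le_1: "smooth_box k l u y \<le> 1"
  unfolding smooth_box_def
  by (intro mult_nonneg_nonneg mult_le_one prod_nonneg prod_le_1 conjI smooth_step_nonneg smooth_step_le_1
      smooth_interval_nonneg smooth_interval_le_1)+

lemma smooth_box_outside: "y \<notin> box l u \<Longrightarrow> smooth_box k l u y = 0"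
proof -
  assume "y \<notin> box l u"
  then obtain i where i: "i \<in> Basis" "y \<bullet> i \<le> l \<bullet> i \<or> u \<bullet> i \<le> y \<bullet> i"
    by (auto simp: mem_box not_less)
  then have "(\<Prod>i\<in>Basis. smooth_interval k (l \<bullet> i) (u \<bullet> i) (y \<bullet> i)) = 0"
    using smooth_interval_outside by (intro prod_zero) (auto intro!: bexI[of _ i])
  then show ?thesis by (simp add: smooth_box_def)
qed

lemma smooth_smooth_box:
  assumes f: "\<And>i. i \<in> Basis \<Longrightarrow> smooth (\<lambda>x. f x \<bullet> i)" and ff: "smooth (\<lambda>x. f x \<bullet> f x)"
  shows "smooth (\<lambda>x. smooth_box k l u (f x))"
  unfolding smooth_box_def
  by (intro smooth_mult smooth_smooth_step_compose smooth_diff smooth_const ff smooth_prod smooth_smooth_interval f)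

lemma smooth_fst: "smooth (\<lambda>z::real \<times> 'a::euclidean_space. fst z)"
  using smooth_inner[of "(1, 0) :: real \<times> 'a"] by (simp add: inner_prod_def)

lemma smooth_snd_inner: "smooth (\<lambda>z::real \<times> 'a::euclidean_space. snd z \<bullet> v)"
  using smooth_inner[of "(0, v) :: real \<times> 'a"] by (simp add: inner_prod_def)

lemma smooth_snd_inner_self: "smooth (\<lambda>z::real \<times> 'a::euclidean_space. snd z \<bullet> snd z)"
  unfolding euclidean_inner[of "snd z" "snd z" for z] by (intro smooth_sum smooth_mult smooth_snd_inner)

context vortex
begin

text \<open>
  The inverse flow of the truncated vortex, as a function on space-time.
\<close>

definition cut_rot :: "nat \<Rightarrow> real \<times> (real^'n) \<Rightarrow> real^'n" where
  "cut_rot N z = rot (axis p 1) (axis q 1) (- (fst z * cut_speed N (snd z \<bullet> snd z))) (snd z)"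

lemma cut_rot_inner_self: "cut_rot N z \<bullet> cut_rot N z = snd z \<bullet> snd z"
  by (simp add: cut_rot_def rot_inner_self[OF orthonormal_pq])

lemma smooth_cut_rot: "smooth (\<lambda>z. cut_rot N z \<bullet> v)"
proof -
  have 1: "smooth (\<lambda>z::real \<times> (real^'n). - (fst z * cut_speed N (snd z \<bullet> snd z)))"
    by (intro smooth_minus smooth_mult smooth_fst smooth_compose[OF smooth_cut_speed] smooth_snd_inner_self)
  show ?thesis
    unfolding cut_rot_def rot_def inner_add_left inner_scaleR_left
    by (intro smooth_add smooth_mult smooth_diff smooth_snd_inner smooth_const smooth_sin[OF 1] smooth_cos[OF 1])
qed

lemma cut_rot_flow:
  assumes "\<rho> N \<le> y \<bullet> y"
  shows "cut_rot N (t, flow t y) = y"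
  using cut_speed_eq_speed[OF assms]
  by (simp add: cut_rot_def flow_inner_self) (simp add: flow_def rot_minus[OF orthonormal_pq])

text \<open>
  These test functions take the place of a regularisation of the solution. The function
  \<open>(t, x) \<mapsto> \<alpha> t * smooth_box k l u (X_{-t} x)\<close>, where \<open>X\<close> is the flow, is an admissible test function, and in the
  moving coordinates it is a product. Spheres around the origin are invariant and \<open>smooth_box\<close> vanishes near the
  origin, so \<open>X\<close> may be replaced by the smooth flow of a truncated vortex without changing this function.
\<close>

lemma test_function_along_flow:
  assumes "0 \<le> a"
  obtains \<phi> where "test_function \<phi>"
    "\<And>t y. t \<ge> 0 \<Longrightarrow> material_derivative \<phi> (t, flow t y) = smooth_interval k a c t * smooth_box k l u y"
proof -
  have sm\<beta>: "smooth (smooth_interval k a c)"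
    using smooth_smooth_interval[OF smooth_ident] .
  have "smooth_interval k a c t = 0" if "t \<le> 0 \<or> max 0 c \<le> t" for t
    using that assms by (intro smooth_interval_outside) auto
  then obtain \<alpha> where \<alpha>: "test_function \<alpha>"
    "\<And>t. t \<ge> 0 \<Longrightarrow> (\<alpha> has_real_derivative smooth_interval k a c t) (at t)"
    using test_function_with_prescribed_derivative[OF sm\<beta>, of "max 0 c"] by auto
  have "(\<lambda>N. real k * \<rho> N) \<longlonglongrightarrow> real k * 0"
    by (intro tendsto_intros \<rho>_tendsto_0)
  then have "\<forall>\<^sub>F N in sequentially. real k * \<rho> N < 1"
    by (rule order_tendstoD) simp
  then obtain N where N: "real k * \<rho> N < 1"
    by (auto simp: eventually_sequentially)
  define \<phi> where "\<phi> z = \<alpha> (fst z) * smooth_box k l u (cut_rot N z)" for z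
  have test: "test_function \<phi>"
  proof (rule test_functionI)
    show "smooth \<phi>"
      unfolding \<phi>_def[abs_def]
    proof (intro smooth_mult smooth_smooth_box smooth_cut_rot)
      show "smooth (\<lambda>z::real \<times> (real^'n). \<alpha> (fst z))"
        using smooth_compose[OF test_function_smooth[OF \<alpha>(1)] smooth_fst] .
      show "smooth (\<lambda>z. cut_rot N z \<bullet> cut_rot N z)"
        unfolding cut_rot_inner_self by (rule smooth_snd_inner_self)
    qed
    obtain R1 where R1: "\<And>t. \<alpha> t \<noteq> 0 \<Longrightarrow> \<bar>t\<bar> \<le> R1"
      using test_function_bounded[OF \<alpha>(1)] by (auto simp: bounded_iff)
    obtain R2 where R2: "\<And>y. y \<in> box l u \<Longrightarrow> norm y \<le> R2"
      using bounded_box[of l u] by (auto simp: bounded_iff)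
    show "bounded {z. \<phi> z \<noteq> 0}"
    proof (rule bounded_subset[OF bounded_Times])
      show "bounded (cball (0::real) R1)" "bounded (cball (0::real^'n) R2)" by auto
      have "norm (cut_rot N z) = norm (snd z)" for z
        by (simp add: norm_eq_sqrt_inner cut_rot_inner_self)
      then show "{z. \<phi> z \<noteq> 0} \<subseteq> cball 0 R1 \<times> cball 0 R2"
        using R1 R2[of "cut_rot N _"] smooth_box_outside[of "cut_rot N _" l u k]
        by (auto simp: \<phi>_def) metis
    qed
  qed
  have along: "\<phi> (t, flow t y) = \<alpha> t * smooth_box k l u y" for t y
  proof (cases "\<rho> N \<le> y \<bullet> y")
    case True
    then show ?thesis by (simp add: \<phi>_def cut_rot_flow)
  next
    case False
    then have "real k * (y \<bullet> y) \<le> real k * \<rho> N" by (intro mult_left_mono) auto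
    then have "real k * (y \<bullet> y) - 1 \<le> 0" using N by linarith
    then have "smooth_box k l u y = 0" "smooth_box k l u (cut_rot N (t, flow t y)) = 0"
      by (simp_all add: smooth_box_def cut_rot_inner_self flow_inner_self smooth_step_zero)
    then show ?thesis by (simp add: \<phi>_def)
  qed
  have "material_derivative \<phi> (t, flow t y) = smooth_interval k a c t * smooth_box k l u y" if "t \<ge> 0" for t y
  proof (rule DERIV_unique)
    show "((\<lambda>t. \<phi> (t, flow t y)) has_real_derivative material_derivative \<phi> (t, flow t y)) (at t)"
      by (rule material_derivative_along_flow[OF test_function_smooth[OF test]])
    show "((\<lambda>t. \<phi> (t, flow t y)) has_real_derivative smooth_interval k a c t * smooth_box k l u y) (at t)"
      unfolding along by (rule DERIV_cmult_right[OF \<alpha>(2)[OF that]])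
  qed
  with test that show ?thesis by blast
qed

text \<open>
  In the coordinates that move with the flow, the weak equation says that \<open>W = w \<circ> space_time_flow\<close> is orthogonal to all products of a
  smooth bump in \<open>t > 0\<close> and a smooth box in space. In the limit \<open>W\<close> has vanishing integral over all boxes.
\<close>

lemma AE_eq_0_if_weakly_transported:
  assumes w[measurable]: "w \<in> borel_measurable borel" and M: "AE z in lborel. \<bar>w z\<bar> \<le> M" and "M > 0"
    and neg: "\<And>t x. t < 0 \<Longrightarrow> w (t, x) = 0"
    and weak: "\<And>\<phi>. test_function \<phi> \<Longrightarrow> (\<integral>z. w z * material_derivative \<phi> z \<partial>lborel) = 0"
  shows "AE z in lborel. w z = 0"
proof -
  define W where "W z = w (space_time_flow z)" for z
  have [measurable]: "W \<in> borel_measurable borel" unfolding W_def by measurable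
  have W_bound: "AE z in lborel. \<bar>W z\<bar> \<le> M"
    unfolding W_def
    using AE_preserves_lborel[OF preserves_lborel_space_time_flow, of "\<lambda>z. \<bar>w z\<bar> \<le> M"] M by simp
  have W_neg: "W (t, x) = 0" if "t < 0" for t x
    using that by (simp add: W_def space_time_flow_def neg)
  have nonneg_box: "(\<integral>z. W z * (indicat_real {a<..<c} (fst z) * indicat_real (box l u) (snd z)) \<partial>lborel) = 0"
    if a: "a \<ge> 0" for a c l u
  proof -
    define \<eta> where "\<eta> k z = smooth_interval k a c (fst z) * smooth_box k l u (snd z)" for k and z :: "real \<times> (real^'n)"
    have [measurable]: "\<eta> k \<in> borel_measurable borel" for k
    proof -
      have "smooth (\<eta> k)"
        unfolding \<eta>_def[abs_def]
        by (intro smooth_mult smooth_smooth_interval smooth_smooth_box smooth_fst smooth_snd_inner smooth_snd_inner_self)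
      then show ?thesis by (intro borel_measurable_continuous_onI smooth_continuous)
    qed
    have "(\<integral>z. W z * \<eta> k z \<partial>lborel) = 0" for k
    proof -
      obtain \<phi> where \<phi>: "test_function \<phi>"
        "\<And>t y. t \<ge> 0 \<Longrightarrow> material_derivative \<phi> (t, flow t y) = smooth_interval k a c t * smooth_box k l u y"
        using test_function_along_flow[OF a] by blast
      note [measurable] = borel_measurable_material_derivative[OF \<phi>(1)]
      have "W z * \<eta> k z = w (space_time_flow z) * material_derivative \<phi> (space_time_flow z)" for z
      proof (cases "fst z < 0")
        case True
        then have "W z = 0" using W_neg[of "fst z" "snd z"] by simp
        then show ?thesis by (simp add: W_def)
      qed (simp add: W_def \<eta>_def \<phi>(2)[of "fst z" "snd z"] space_time_flow_def)
      then have "(\<integral>z. W z * \<eta> k z \<partial>lborel)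
          = (\<integral>z. w (space_time_flow z) * material_derivative \<phi> (space_time_flow z) \<partial>lborel)" by simp
      also have "\<dots> = (\<integral>z. w z * material_derivative \<phi> z \<partial>lborel)"
        by (rule integral_preserves_lborel[OF preserves_lborel_space_time_flow]) measurable
      finally show ?thesis using weak[OF \<phi>(1)] by simp
    qed
    moreover have "(\<lambda>k. \<integral>z. W z * \<eta> k z \<partial>lborel)
        \<longlonglongrightarrow> (\<integral>z. W z * (indicat_real {a<..<c} (fst z) * indicat_real (box l u) (snd z)) \<partial>lborel)"
    proof (rule integral_dominated_convergence)
      show "integrable lborel (\<lambda>z::real \<times> (real^'n). M * indicat_real (cbox (a, l) (c, u)) z)"
        using emeasure_lborel_cbox_finite[of "(a, l)" "(c, u)"]
        by (intro integrable_mult_right) (auto intro!: integrable_real_indicator)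
      show "AE z in lborel. norm (W z * \<eta> k z) \<le> M * indicat_real (cbox (a, l) (c, u)) z" for k
        using W_bound
      proof eventually_elim
        case (elim z)
        have \<eta>_bound: "0 \<le> \<eta> k z" "\<eta> k z \<le> 1"
          by (auto simp: \<eta>_def smooth_interval_nonneg smooth_interval_le_1 smooth_box_nonneg smooth_box_le_1 intro!: mult_le_one)
        show ?case
        proof (cases "z \<in> cbox (a, l) (c, u)")
          case True
          then show ?thesis
            using elim \<eta>_bound mult_mono[of "\<bar>W z\<bar>" M "\<eta> k z" 1] by (simp add: abs_mult)
        next
          case False
          then have "fst z \<le> a \<or> c \<le> fst z \<or> snd z \<notin> box l u"
            using box_subset_cbox[of l u] by (cases z) (auto simp: cbox_Pair_eq)
          then have "\<eta> k z = 0"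
            using smooth_interval_outside[of "fst z" a c k] smooth_box_outside[of "snd z" l u k]
            by (auto simp: \<eta>_def)
          then show ?thesis using \<open>M > 0\<close> by simp
        qed
      qed
      have "(\<lambda>k. W z * \<eta> k z) \<longlonglongrightarrow> W z * (indicat_real {a<..<c} (fst z) * indicat_real (box l u) (snd z))"
        if "snd z \<noteq> 0" for z
        unfolding \<eta>_def
        by (intro tendsto_mult tendsto_const smooth_interval_tendsto smooth_box_tendsto that)
      moreover have "AE z in (lborel :: (real \<times> (real^'n)) measure). snd z \<noteq> 0"
      proof -
        have "AE z in (lborel :: (real \<times> (real^'n)) measure). z \<bullet> (0, axis p 1) \<noteq> 0"
          by (rule AE_lborel_inner_neq) (auto simp: Basis_prod_def)
        then show ?thesis by eventually_elim (auto simp: inner_prod_def)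
      qed
      ultimately show "AE z in lborel. (\<lambda>k. W z * \<eta> k z)
          \<longlonglongrightarrow> W z * (indicat_real {a<..<c} (fst z) * indicat_real (box l u) (snd z))"
        by (auto elim: eventually_mono)
    qed measurable
    ultimately show ?thesis by (simp add: LIMSEQ_const_iff)
  qed
  \<comment> \<open>the box is cut off at time \<open>0\<close>, where \<open>W\<close> starts; the slice \<open>t = 0\<close> is a null set\<close>
  have "AE z in lborel. W z = 0"
  proof (rule AE_eq_0_if_box_integrals_eq_0[OF _ W_bound \<open>M > 0\<close>])
    fix l u :: "real \<times> (real^'n)"
    have "AE z in (lborel :: (real \<times> (real^'n)) measure). z \<bullet> (1, 0) \<noteq> 0"
      by (rule AE_lborel_inner_neq) (auto simp: Basis_prod_def)
    then have "AE z in lborel. W z * indicat_real (box l u) z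
        = W z * (indicat_real {max 0 (fst l)<..<fst u} (fst z) * indicat_real (box (snd l) (snd u)) (snd z))"
    proof eventually_elim
      case (elim z)
      have box: "z \<in> box l u \<longleftrightarrow> fst z \<in> {fst l<..<fst u} \<and> snd z \<in> box (snd l) (snd u)"
        by (auto simp: mem_box Basis_prod_def inner_prod_def)
      consider "fst z < 0" | "fst z > 0" using elim by (force simp: inner_prod_def)
      then show ?case
      proof cases
        case 1
        then show ?thesis using W_neg[of "fst z" "snd z"] by simp
      qed (auto simp: indicator_def box)
    qed
    then have "(\<integral>z. W z * indicat_real (box l u) z \<partial>lborel)
        = (\<integral>z. W z * (indicat_real {max 0 (fst l)<..<fst u} (fst z) * indicat_real (box (snd l) (snd u)) (snd z)) \<partial>lborel)"
      by (intro integral_cong_AE) measurable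
    also have "\<dots> = 0" by (rule nonneg_box) simp
    finally show "(\<integral>z. W z * indicat_real (box l u) z \<partial>lborel) = 0" .
  qed measurable
  then show ?thesis
    unfolding W_def
    using AE_preserves_lborel[OF preserves_lborel_space_time_flow, of "\<lambda>z. w z = 0"] by simp
qed

lemma transport_solution_unique:
  assumes u: "transport_solution (\<lambda>_. b) u0 u" and v: "transport_solution (\<lambda>_. b) u0 v"
  shows "AE (t, x) in lborel. t \<ge> 0 \<longrightarrow> v t x = u t x"
proof -
  have bounded_part: "\<exists>M. (\<lambda>z. indicat_real {0..} (fst z) * u (fst z) (snd z)) \<in> borel_measurable borel
      \<and> (AE z in lborel. \<bar>indicat_real {0..} (fst z) * u (fst z) (snd z)\<bar> \<le> M)"
    if Linf: "L_infinity ({0..} \<times> (UNIV :: (real^'n) set)) (\<lambda>(t, x). u t x)" for u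
  proof -
    have eq: "(\<lambda>z. indicat_real ({0..} \<times> (UNIV :: (real^'n) set)) z *\<^sub>R (case z of (t, x) \<Rightarrow> u t x))
        = (\<lambda>z. indicat_real {0..} (fst z) * u (fst z) (snd z))"
      by (auto simp: indicator_def fun_eq_iff)
    have "(\<lambda>z. indicat_real {0..} (fst z) * u (fst z) (snd z)) \<in> borel_measurable borel"
      using Linf unfolding L_infinity_def set_borel_measurable_def eq by simp
    moreover obtain M where "AE z in lborel. z \<in> {0..} \<times> (UNIV :: (real^'n) set) \<longrightarrow> norm (case z of (t, x) \<Rightarrow> u t x) \<le> M"
      using Linf unfolding L_infinity_def by blast
    then have "AE z in lborel. \<bar>indicat_real {0..} (fst z) * u (fst z) (snd z)\<bar> \<le> \<bar>M\<bar>"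
      by eventually_elim (auto simp: indicator_def)
    ultimately show ?thesis by blast
  qed
  define U V where "U z = indicat_real {0..} (fst z) * u (fst z) (snd z)"
    and "V z = indicat_real {0..} (fst z) * v (fst z) (snd z)" for z
  obtain MU MV where [measurable]: "U \<in> borel_measurable borel" "V \<in> borel_measurable borel"
    and MU: "AE z in lborel. \<bar>U z\<bar> \<le> MU" and MV: "AE z in lborel. \<bar>V z\<bar> \<le> MV"
    using bounded_part[of u] bounded_part[of v] u v
    unfolding transport_solution_def U_def[abs_def] V_def[abs_def] by blast
  have "AE z in lborel. V z - U z = 0"
  proof (rule AE_eq_0_if_weakly_transported)
    show "(\<lambda>z. V z - U z) \<in> borel_measurable borel" by measurable
    show "AE z in lborel. \<bar>V z - U z\<bar> \<le> \<bar>MU\<bar> + \<bar>MV\<bar> + 1"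
      using MU MV by eventually_elim auto
    show "V (t, x) - U (t, x) = 0" if "t < 0" for t x using that by (simp add: U_def V_def)
    fix \<phi> :: "real \<times> (real^'n) \<Rightarrow> real" assume test: "test_function \<phi>"
    have "integrable lborel (\<lambda>z. U z * material_derivative \<phi> z)"
        "integrable lborel (\<lambda>z. V z * material_derivative \<phi> z)"
      by (rule integrable_times_material_derivative[OF _ MU test] integrable_times_material_derivative[OF _ MV test], measurable)+
    moreover have "(\<integral>z. U z * material_derivative \<phi> z \<partial>lborel) = (\<integral>z. V z * material_derivative \<phi> z \<partial>lborel)"
    proof -
      have "(\<integral>z. U z * material_derivative \<phi> z \<partial>lborel) + (\<integral>x. u0 x * \<phi> (0, x) \<partial>lborel) = 0"
        using u test unfolding transport_solution_iff U_def by blast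
      moreover have "(\<integral>z. V z * material_derivative \<phi> z \<partial>lborel) + (\<integral>x. u0 x * \<phi> (0, x) \<partial>lborel) = 0"
        using v test unfolding transport_solution_iff V_def by blast
      ultimately show ?thesis by linarith
    qed
    ultimately show "(\<integral>z. (V z - U z) * material_derivative \<phi> z \<partial>lborel) = 0"
      by (simp add: left_diff_distrib)
  qed auto
  then show ?thesis
    by eventually_elim (auto simp: U_def V_def)
qed

end

section \<open>Loss of Lipschitz regularity\<close>

abbreviation smooth_step' :: "real \<Rightarrow> real" where
  "smooth_step' \<equiv> pderiv_dir smooth_step 1"

lemma smooth_step_has_derivative: "(smooth_step has_real_derivative smooth_step' x) (at x)"
  by (rule smooth_has_real_derivative[OF smooth_smooth_step])

lemma smooth_step'_bounded_on_unit: obtains L where "\<And>x. \<bar>x\<bar> \<le> 1 \<Longrightarrow> \<bar>smooth_step' x\<bar> \<le> L"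
proof -
  have "continuous_on {-1..1} smooth_step'"
    by (rule continuous_on_subset[OF smooth_continuous[OF smooth_pderiv_dir[OF smooth_smooth_step]]]) auto
  then have "bounded (smooth_step' ` {-1..1})"
    by (intro compact_imp_bounded compact_continuous_image) auto
  then show ?thesis using that by (force simp: bounded_iff abs_le_iff)
qed

definition cutoff :: "real \<Rightarrow> real" where
  "cutoff s = smooth_step (1/5 - s)"

definition datum :: "'n \<Rightarrow> real^'n \<Rightarrow> real" where
  "datum p x = cutoff (x \<bullet> x) * (x \<bullet> axis p 1)"

lemma cutoff_outside: "1/5 \<le> s \<Longrightarrow> cutoff s = 0"
  by (simp add: cutoff_def smooth_step_zero)

lemma smooth_cutoff_inner_self: "smooth (\<lambda>x. cutoff (x \<bullet> x))"
  unfolding cutoff_def by (intro smooth_smooth_step_compose smooth_diff smooth_const smooth_inner_self)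

lemma smooth_datum: "smooth (datum p)"
  unfolding datum_def[abs_def] by (intro smooth_mult smooth_cutoff_inner_self smooth_inner)

lemma supp_subset_cball:
  fixes f :: "real^'n \<Rightarrow> real"
  assumes "\<And>x. 1/5 \<le> x \<bullet> x \<Longrightarrow> f x = 0"
  shows "{x. f x \<noteq> 0} \<subseteq> cball 0 (sqrt (1/5))"
proof
  fix x assume "x \<in> {x. f x \<noteq> 0}"
  then have "x \<bullet> x < 1/5" using assms[of x] by force
  then show "x \<in> cball 0 (sqrt (1/5))" unfolding mem_cball_0 norm_eq_sqrt_inner by simp
qed

lemma cball_subset_half_ball: "cball (0::real^'n) (sqrt (1/5)) \<subseteq> ball 0 (1/2)"
proof -
  have "sqrt (1/5) < 1/2" by (rule real_less_lsqrt) (auto simp: power2_eq_square)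
  then show ?thesis by auto
qed

context vortex
begin

lemma transported_datum:
  "transported (datum p) t x = cutoff (x \<bullet> x)
     * (cos (t * speed (x \<bullet> x)) * (x \<bullet> axis p 1) + sin (t * speed (x \<bullet> x)) * (x \<bullet> axis q 1))"
  by (simp add: transported_def datum_def flow_inner_self)
    (simp add: flow_def rot_inner_p[OF orthonormal_pq])

text \<open>
  The solution for the truncated vortex. It is smooth, and it agrees with the solution itself outside any given
  neighbourhood of the origin if \<open>N\<close> is large.
\<close>

definition cut_transported :: "nat \<Rightarrow> real \<Rightarrow> real^'n \<Rightarrow> real" where
  "cut_transported N t x = cutoff (x \<bullet> x)
     * (cos (t * cut_speed N (x \<bullet> x)) * (x \<bullet> axis p 1) + sin (t * cut_speed N (x \<bullet> x)) * (x \<bullet> axis q 1))"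

lemma smooth_cut_transported: "smooth (cut_transported N t)"
proof -
  have 1: "smooth (\<lambda>x::real^'n. t * cut_speed N (x \<bullet> x))"
    by (intro smooth_mult smooth_const smooth_compose[OF smooth_cut_speed] smooth_inner_self)
  show ?thesis
    unfolding cut_transported_def[abs_def]
    by (intro smooth_mult smooth_add smooth_cutoff_inner_self smooth_inner smooth_cos[OF 1] smooth_sin[OF 1])
qed

lemma cut_speed'_on_shell:
  assumes "1/4 < z" "z < 1"
  shows "cut_speed' (Suc n) (z * \<rho> n) = real n / \<rho> n * bump' z"
proof -
  have "bump' (z * \<rho> n / \<rho> m) = 0" if "m < n" for m
  proof (rule bump_scaled_outside)
    have "\<rho> n \<le> \<rho> m / 4" using \<rho>_antimono[of "Suc m" n] \<rho>_quarter[of m] that by simp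
    moreover have "z * \<rho> n \<le> \<rho> n" using assms \<rho>_pos[of n] by simp
    ultimately show "z * \<rho> n \<le> \<rho> m / 4 \<or> \<rho> m \<le> z * \<rho> n" by simp
  qed
  then show ?thesis
    using \<rho>_pos[of n] by (simp add: cut_speed'_def)
qed

text \<open>
  On a coordinate ray the solution is \<open>r \<mapsto> r * g (t * speed (r\<^sup>2))\<close> up to the cutoff, with \<open>g\<close> the sine or the
  cosine. In its derivative all terms are bounded except the one in which the phase is differentiated.
\<close>

lemma radial_derivative_lower_bound:
  assumes F: "smooth F" and F_ray: "\<And>r. F (r *\<^sub>R e) = cutoff (r * r) * (g (t * cut_speed N (r * r)) * r)"
    and g: "\<And>x. (g has_real_derivative g' x) (at x)" "\<And>x. \<bar>g x\<bar> \<le> 1"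
    and r: "r * r \<le> 1" and L: "\<And>x. \<bar>x\<bar> \<le> 1 \<Longrightarrow> \<bar>smooth_step' x\<bar> \<le> L"
    and K: "\<bar>pderiv_dir F e (r *\<^sub>R e)\<bar> \<le> K"
  shows "cutoff (r * r) * (2 * (r * r) * \<bar>t * cut_speed' N (r * r)\<bar>) * \<bar>g' (t * cut_speed N (r * r))\<bar> \<le> K + 1 + 2 * L"
proof -
  let ?s = "r * r"
  let ?c = "t * cut_speed N ?s"
  let ?\<chi>' = "smooth_step' (1/5 - ?s)"
  have sq: "((\<lambda>r. r * r) has_real_derivative 2 * r) (at r)"
    by (auto intro!: derivative_eq_intros)
  have "((\<lambda>r. t * cut_speed N (r * r)) has_real_derivative t * (cut_speed' N ?s * (2 * r))) (at r)"
    by (rule DERIV_cmult[OF DERIV_chain2[OF cut_speed_has_derivative sq]])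
  from DERIV_chain2[OF g(1) this]
  have G: "((\<lambda>r. g (t * cut_speed N (r * r))) has_real_derivative g' ?c * (t * (cut_speed' N ?s * (2 * r)))) (at r)" .
  have "((\<lambda>r. 1/5 - r * r) has_real_derivative - (2 * r)) (at r)"
    using DERIV_diff[OF DERIV_const sq] by simp
  from DERIV_chain2[OF smooth_step_has_derivative this]
  have X: "((\<lambda>r. cutoff (r * r)) has_real_derivative ?\<chi>' * - (2 * r)) (at r)"
    by (simp add: cutoff_def)
  have "((\<lambda>r. F (r *\<^sub>R e)) has_real_derivative
      cutoff ?s * (g ?c * 1 + g' ?c * (t * (cut_speed' N ?s * (2 * r))) * r)
      + (?\<chi>' * - (2 * r)) * (g ?c * r)) (at r)"
    unfolding F_ray using DERIV_mult[OF X DERIV_mult[OF G DERIV_ident]]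
    by (simp add: algebra_simps)
  moreover have "((\<lambda>r. F (r *\<^sub>R e)) has_real_derivative pderiv_dir F e (r *\<^sub>R e)) (at r)"
  proof -
    have "Ck 1 F" using F unfolding smooth_def by blast
    from Ck_1_line_derivative[OF this, of 0 e r] show ?thesis by simp
  qed
  ultimately have D: "pderiv_dir F e (r *\<^sub>R e)
      = cutoff ?s * (2 * ?s * (t * cut_speed' N ?s)) * g' ?c + cutoff ?s * g ?c - 2 * (?s * ?\<chi>' * g ?c)"
    using DERIV_unique by (fastforce simp: algebra_simps)
  have cut: "0 \<le> cutoff ?s" "cutoff ?s \<le> 1" by (simp_all add: cutoff_def smooth_step_nonneg smooth_step_le_1)
  have s: "0 \<le> ?s" by simp
  have 1: "\<bar>cutoff ?s * g ?c\<bar> \<le> 1"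
    unfolding abs_mult using cut g(2)[of ?c] by (intro mult_le_one) auto
  have "\<bar>1/5 - ?s\<bar> \<le> 1" using r s by (auto simp: abs_le_iff simp del: zero_le_square)
  then have "\<bar>?\<chi>'\<bar> \<le> L" by (rule L)
  then have "\<bar>?s\<bar> * \<bar>?\<chi>'\<bar> * \<bar>g ?c\<bar> \<le> 1 * L * 1"
    using r s g(2)[of ?c] order_trans[OF abs_ge_zero \<open>\<bar>?\<chi>'\<bar> \<le> L\<close>]
    by (intro mult_mono) (auto simp del: zero_le_square)
  then have 2: "\<bar>?s * ?\<chi>' * g ?c\<bar> \<le> L" by (simp only: abs_mult)
  have "\<bar>cutoff ?s * (2 * ?s * (t * cut_speed' N ?s)) * g' ?c\<bar> \<le> K + 1 + 2 * L"
    using D 1 2 K by linarith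
  then show ?thesis using cut(1) s by (simp add: abs_mult)
qed

text \<open>
  Fix \<open>z\<close> in the shell interval with \<open>bump' z \<noteq> 0\<close> and look at the two points with \<open>\<bar>x\<bar>\<^sup>2 = z * \<rho> n\<close> on the rays of \<open>p\<close> and
  \<open>q\<close>. The radial derivatives there have, up to bounded terms, the size of a constant times \<open>n * t\<close>, times \<open>\<bar>sin c\<bar>\<close> and \<open>\<bar>cos c\<bar>\<close>
  respectively, with the same phase \<open>c\<close>. Sine and cosine are not both small, so one of the two derivatives is large, whatever
  the phase is.
\<close>

lemma no_bounded_weak_gradient:
  assumes t: "t > 0"
  shows "\<not> (\<exists>g. weak_gradient (transported (datum p) t) g \<and> L_infinity UNIV g)"
proof
  assume "\<exists>g. weak_gradient (transported (datum p) t) g \<and> L_infinity UNIV g"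
  then obtain g K where wg: "weak_gradient (transported (datum p) t) g"
    and K: "AE x in lborel. norm (g x) \<le> K"
    by (auto simp: L_infinity_def)
  obtain z where z: "1/4 < z" "z < 1" "bump' z \<noteq> 0" using bump'_nonzero .
  obtain L where L: "\<And>x. \<bar>x\<bar> \<le> 1 \<Longrightarrow> \<bar>smooth_step' x\<bar> \<le> L" using smooth_step'_bounded_on_unit by blast
  note ps = orthonormal_simps[OF orthonormal_pq]
  have bound: "smooth_step (1/10) * (2 * z * t * \<bar>bump' z\<bar>) * real n \<le> 2 * (K + 1 + 2 * L)" for n
  proof -
    define r where "r = sqrt (z * \<rho> n)"
    have rr: "r * r = z * \<rho> n" using z \<rho>_pos[of n] by (simp add: r_def)
    have r_small: "r * r \<le> 1/10"
    proof -
      have "z * \<rho> n \<le> 1 * \<rho> 0" using z \<rho>_pos[of n] \<rho>_antimono[of 0 n] by (intro mult_mono) auto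
      then show ?thesis using rr \<rho>_0 by simp
    qed
    have outer: "\<rho> (Suc n) < r * r"
    proof -
      have "1/4 * \<rho> n < z * \<rho> n" using z \<rho>_pos[of n] by (intro mult_strict_right_mono)
      then show ?thesis using rr \<rho>_quarter[of n] by simp
    qed
    define F where "F = cut_transported (Suc n) t"
    have F: "smooth F" unfolding F_def by (rule smooth_cut_transported)
    have partial: "\<bar>pderiv_dir F (axis i 1) (r *\<^sub>R axis i 1)\<bar> \<le> K" for i
    proof -
      have "open {x::real^'n. \<rho> (Suc n) < x \<bullet> x}"
        by (intro open_Collect_less continuous_intros)
      moreover have "r *\<^sub>R axis i 1 \<in> {x::real^'n. \<rho> (Suc n) < x \<bullet> x}"
        using outer by (simp add: inner_axis_axis)
      ultimately obtain d where d: "d > 0" "ball (r *\<^sub>R axis i 1) d \<subseteq> {x::real^'n. \<rho> (Suc n) < x \<bullet> x}"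
        by (meson openE)
      have "transported (datum p) t x = F x" if "x \<in> ball (r *\<^sub>R axis i 1) d" for x
        using d(2) that cut_speed_eq_speed[of "Suc n" "x \<bullet> x"]
        by (auto simp: F_def cut_transported_def transported_datum)
      then show ?thesis
        using F d(1) by (intro weak_gradient_bound_imp_pderiv_bound[OF wg K]) (auto simp: smooth_def)
    qed
    define c where "c = t * cut_speed (Suc n) (r * r)"
    have F_p: "F (r *\<^sub>R axis p 1) = cutoff (r * r) * (cos (t * cut_speed (Suc n) (r * r)) * r)"
      and F_q: "F (r *\<^sub>R axis q 1) = cutoff (r * r) * (sin (t * cut_speed (Suc n) (r * r)) * r)" for r
      by (simp_all add: F_def cut_transported_def ps)
    have "r * r \<le> 1" using r_small by simp
    define a where "a = cutoff (r * r) * (2 * (r * r) * \<bar>t * cut_speed' (Suc n) (r * r)\<bar>)"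
    have 1: "a * \<bar>- sin c\<bar> \<le> K + 1 + 2 * L"
      unfolding a_def c_def
      by (rule radial_derivative_lower_bound[OF F F_p _ _ \<open>r * r \<le> 1\<close> L partial]) (auto intro: DERIV_cos)
    have 2: "a * \<bar>cos c\<bar> \<le> K + 1 + 2 * L"
      unfolding a_def c_def
      by (rule radial_derivative_lower_bound[OF F F_q _ _ \<open>r * r \<le> 1\<close> L partial]) (auto intro: DERIV_sin)
    have "cutoff (r * r) \<ge> smooth_step (1/10)"
      unfolding cutoff_def using r_small by (intro smooth_step_mono) simp
    moreover have amplitude: "2 * (r * r) * \<bar>t * cut_speed' (Suc n) (r * r)\<bar> = 2 * z * t * \<bar>bump' z\<bar> * real n"
      unfolding rr cut_speed'_on_shell[OF z(1,2)] using t z \<rho>_pos[of n] by (simp add: abs_mult)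
    ultimately have a: "smooth_step (1/10) * (2 * z * t * \<bar>bump' z\<bar> * real n) \<le> a"
      unfolding a_def amplitude using t z by (intro mult_right_mono) auto
    then have "a \<ge> 0" using t z smooth_step_nonneg[of "1/10"] by (intro order_trans[OF _ a]) auto
    have "1 \<le> \<bar>sin c\<bar> + \<bar>cos c\<bar>"
    proof -
      have "1 = \<bar>sin c\<bar> * \<bar>sin c\<bar> + \<bar>cos c\<bar> * \<bar>cos c\<bar>"
        using sin_cos_squared_add[of c] by (simp add: power2_eq_square)
      also have "\<dots> \<le> \<bar>sin c\<bar> * 1 + \<bar>cos c\<bar> * 1"
        by (intro add_mono mult_left_mono) auto
      finally show ?thesis by simp
    qed
    then have "a * 1 \<le> a * (\<bar>sin c\<bar> + \<bar>cos c\<bar>)" using \<open>a \<ge> 0\<close> by (intro mult_left_mono)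
    also have "\<dots> \<le> 2 * (K + 1 + 2 * L)" using 1 2 by (simp add: distrib_left)
    finally show ?thesis using a by (simp add: mult.assoc)
  qed
  have "smooth_step (1/10) * (2 * z * t * \<bar>bump' z\<bar>) > 0"
    using z t smooth_step_pos[of "1/10"] by simp
  then obtain n where "2 * (K + 1 + 2 * L) < real n * (smooth_step (1/10) * (2 * z * t * \<bar>bump' z\<bar>))"
    using reals_Archimedean3 by blast
  with bound[of n] show False by (simp add: mult.commute)
qed

end

section \<open>Choice of the radii\<close>

text \<open>
  The factor \<open>D n\<close> absorbs whatever has to be small after multiplication with \<open>\<rho> n\<close>.
\<close>

lemma shell_radii:
  fixes D :: "nat \<Rightarrow> real"
  assumes D: "mono D" "D 0 = 1" and \<rho>: "\<And>n. \<rho> n = 1 / (4 ^ (n + 2) * D n)"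
  shows "\<rho> n > 0" "\<rho> (Suc n) \<le> \<rho> n / 4" "\<rho> 0 \<le> 1/16" "0 \<le> x \<Longrightarrow> x \<le> D n \<Longrightarrow> x * \<rho> n \<le> (1/2) ^ n"
proof -
  have D1: "D n \<ge> 1" for n using monoD[OF D(1), of 0 n] D(2) by simp
  show "\<rho> n > 0" using D1[of n] by (simp add: \<rho>)
  show "\<rho> 0 \<le> 1/16" by (simp add: \<rho> D(2))
  have "4 * (4 ^ (n + 2) * D n) \<le> 4 ^ (Suc n + 2) * D (Suc n)"
    using monoD[OF D(1), of n "Suc n"] by simp
  then have "1 / (4 ^ (Suc n + 2) * D (Suc n)) \<le> 1 / (4 * (4 ^ (n + 2) * D n))"
    using D1[of n] by (intro divide_left_mono) (auto intro!: mult_pos_pos simp: less_le_trans[OF _ D1])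
  then show "\<rho> (Suc n) \<le> \<rho> n / 4" by (simp add: \<rho>)
  assume x: "0 \<le> x" "x \<le> D n"
  have "x * \<rho> n \<le> D n * \<rho> n" using x \<open>\<rho> n > 0\<close> by (intro mult_right_mono) auto
  also have "\<dots> = (1/4) ^ (n + 2)" using D1[of n] by (simp add: \<rho> power_one_over)
  also have "\<dots> \<le> (1/2) ^ (n + 2)" by (intro power_mono) auto
  also have "\<dots> \<le> (1/2) ^ n" by (intro power_decreasing) auto
  finally show "x * \<rho> n \<le> (1/2) ^ n" .
qed

theorem theorem2p4:
  fixes \<Phi> :: "real \<Rightarrow> real"
  assumes "CARD('n::finite) \<ge> 2"
    and "\<Phi> \<in> {0..} \<rightarrow> {0..}" and "mono_on {0..} \<Phi>"
    and "\<Phi> 0 = 0" and "filterlim \<Phi> at_top at_top"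
  shows "\<exists>(b :: real \<Rightarrow> real ^ 'n \<Rightarrow> real ^ 'n) (Db :: real \<Rightarrow> real ^ 'n \<Rightarrow> real ^ 'n ^ 'n)
            (u0 :: real ^ 'n \<Rightarrow> real) (u :: real \<Rightarrow> real ^ 'n \<Rightarrow> real).
     divergence_free_field b \<and>
     (\<forall>t\<ge>0. ess_supp (b t) \<subseteq> ball 0 (1/2)) \<and>
     (\<forall>t>0. weak_jacobian (b t) (Db t)) \<and>
     (SUP t\<in>{0<..}. \<integral>\<^sup>+x\<in>ball 0 (1/2). ennreal (\<Phi> (norm (Db t x))) \<partial>lborel) < \<infinity> \<and>
     Ck 1 u0 \<and> compact (supp u0) \<and> supp u0 \<subseteq> ball 0 (1/2) \<and>
     the_transport_solution b u0 u \<and>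
     (\<forall>t\<ge>0. ess_supp (u t) \<subseteq> ball 0 (1/2)) \<and>
     (\<forall>t>0. \<not> (\<exists>g. weak_gradient (u t) g \<and> L_infinity UNIV g))"
proof -
  obtain p q :: 'n where pq: "p \<noteq> q"
  proof -
    have "\<exists>p q :: 'n. p \<noteq> q"
    proof (rule ccontr)
      assume "\<not> (\<exists>p q :: 'n. p \<noteq> q)"
      then have "(UNIV :: 'n set) = {undefined}" by auto
      then have "CARD('n) = card {undefined :: 'n}" by (rule arg_cong)
      with assms(1) show False by simp
    qed
    with that show ?thesis by blast
  qed
  obtain B where B: "B > 0" "\<And>z. \<bar>bump' z\<bar> \<le> B" using bump'_bounded by blast
  define c0 where "c0 = (1 + 2 * B) * (real CARD('n))\<^sup>2"
  have "c0 \<ge> 0" using B(1) by (simp add: c0_def)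
  have \<Phi>_nonneg: "\<Phi> (c0 * real n) \<ge> 0" for n
    using assms(2) \<open>c0 \<ge> 0\<close> by (auto simp: Pi_iff)
  \<comment> \<open>each summand is a quantity that has to be small after multiplication with \<open>\<rho> n\<close>: the square of the velocity, \<open>\<Phi>\<close> of the velocity gradient, and the gradient itself\<close>
  define D where "D n = 1 + (real n)\<^sup>2 + \<Phi> (c0 * real n) + c0 * real n" for n
  have "mono D"
  proof (rule monoI)
    fix m n :: nat assume "m \<le> n"
    moreover from this have "\<Phi> (c0 * real m) \<le> \<Phi> (c0 * real n)"
      using \<open>c0 \<ge> 0\<close> by (intro mono_onD[OF assms(3)]) (auto intro: mult_left_mono)
    ultimately show "D m \<le> D n"
      unfolding D_def using \<open>c0 \<ge> 0\<close> by (intro add_mono mult_left_mono power_mono) auto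
  qed
  have "D 0 = 1" by (simp add: D_def assms(4))
  define \<rho> where "\<rho> n = 1 / (4 ^ (n + 2) * D n)" for n
  note radii = shell_radii[OF \<open>mono D\<close> \<open>D 0 = 1\<close> \<rho>_def]
  interpret vortex \<rho> p q B
  proof
    fix n
    show "\<rho> n > 0" "\<rho> (Suc n) \<le> \<rho> n / 4" "\<rho> 0 \<le> 1/16" by (rule radii)+
    have "(real n)\<^sup>2 * \<rho> n \<le> (1/2) ^ n"
      using \<Phi>_nonneg[of n] \<open>c0 \<ge> 0\<close> by (intro radii) (auto simp: D_def)
    then show "(real n)\<^sup>2 * \<rho> n \<le> 1" using power_le_one[of "1/2 :: real" n] by simp
  qed (use pq B in auto)
  have C: "C = c0" by (simp add: C_def c0_def)
  have small: "\<Phi> (C * real n) * \<rho> n \<le> (1/2) ^ n" "C * real n * \<rho> n \<le> (1/2) ^ n" for n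
    unfolding C using \<Phi>_nonneg[of n] \<open>c0 \<ge> 0\<close> by (intro radii; simp add: D_def)+
  have "(\<integral>\<^sup>+x. ennreal (norm (Db x)) \<partial>lborel) < \<infinity>"
    using nn_integral_Db_finite[of "\<lambda>r. r"] assms(1) small(2) by (simp add: mono_on_def)
  then have int: "integrable lborel Db"
    by (intro integrableI_bounded) auto
  have "(\<integral>\<^sup>+x\<in>ball 0 (1/2). ennreal (\<Phi> (norm (Db x))) \<partial>lborel) \<le> (\<integral>\<^sup>+x. ennreal (\<Phi> (norm (Db x))) \<partial>lborel)"
    by (intro nn_integral_mono) (auto simp: indicator_def)
  also have "\<dots> < \<infinity>"
    by (rule nn_integral_Db_finite[OF assms(1,3,4) small(1)])
  finally have \<Phi>_finite: "(SUP t\<in>{0::real<..}. \<integral>\<^sup>+x\<in>ball 0 (1/2). ennreal (\<Phi> (norm (Db x))) \<partial>lborel) < \<infinity>"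
    by simp
  have b_supp: "ess_supp b \<subseteq> ball 0 (1/2)"
  proof -
    have "b x = 0" if "x \<notin> cball 0 (sqrt (1/5))" for x
    proof (rule b_outside)
      have "1/5 < x \<bullet> x" using that unfolding mem_cball_0 norm_eq_sqrt_inner by simp
      then show "1/16 \<le> x \<bullet> x" by simp
    qed
    then have "ess_supp b \<subseteq> cball 0 (sqrt (1/5))" by (intro ess_supp_subset) auto
    with cball_subset_half_ball show ?thesis by blast
  qed
  have field: "divergence_free_field (\<lambda>_. b)"
    unfolding divergence_free_field_def
  proof (intro conjI allI impI)
    have "(\<lambda>(t, x). b x) \<in> borel_measurable (borel :: (real \<times> (real^'n)) measure)"
      by (simp add: case_prod_beta)
    then show "locally_integrable ({0..} \<times> UNIV) (\<lambda>(t :: real, x). b x)"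
      by (rule bounded_measurable_locally_integrable) (auto intro: norm_b)
  qed (rule divergence_free_b[OF int])
  let ?init = "datum p" and ?sol = "transported (datum p)"
  have u0_supp: "{x. ?init x \<noteq> 0} \<subseteq> cball 0 (sqrt (1/5))"
    by (rule supp_subset_cball) (simp add: datum_def cutoff_outside)
  then have u0_bounded: "bounded {x. ?init x \<noteq> 0}" by (rule bounded_subset[OF bounded_cball])
  have supp: "compact (supp ?init)" "supp ?init \<subseteq> ball 0 (1/2)"
    using u0_bounded closure_minimal[OF u0_supp closed_cball] cball_subset_half_ball
    by (auto simp: compact_supp_iff) (auto simp: supp_def)
  obtain M0 where M0: "\<And>x. \<bar>?init x\<bar> \<le> M0"
    using continuous_bounded_support_bounded[OF smooth_continuous[OF smooth_datum] u0_bounded] by blast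
  note u0_cont = smooth_continuous[OF smooth_datum, of p]
  have solution: "transport_solution (\<lambda>_. b) ?init ?sol"
    by (rule transport_solution_transported[OF u0_cont M0 u0_bounded])
  have the_solution: "the_transport_solution (\<lambda>_. b) ?init ?sol"
    unfolding the_transport_solution_def
    using solution weak_star_continuous_transported[OF u0_cont M0] transport_solution_unique by blast
  have u_supp: "ess_supp (?sol t) \<subseteq> ball 0 (1/2)" for t
  proof -
    have "{x. ?sol t x \<noteq> 0} \<subseteq> cball 0 (sqrt (1/5))"
      by (rule supp_subset_cball) (simp add: transported_datum cutoff_outside)
    then have "ess_supp (?sol t) \<subseteq> cball 0 (sqrt (1/5))" by (intro ess_supp_subset) auto
    with cball_subset_half_ball show ?thesis by blast
  qed
  have "Ck 1 ?init" using smooth_datum[of p] unfolding smooth_def by blast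
  then show ?thesis
    using field b_supp weak_jacobian_b[OF int] \<Phi>_finite supp the_solution u_supp no_bounded_weak_gradient
    by (intro exI[of _ "\<lambda>_. b"] exI[of _ "\<lambda>_. Db"] exI[of _ ?init] exI[of _ ?sol]) simp
qed

end
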